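(* There does not exist any sequence $(\alpha_k,\beta_k)\in\Sigma_L$ with $\alpha_k,\beta_k>\lambda_1^L$ for all $k$ which converges to a point $(\alpha,\beta)\in\mathbb{R}^2$ with $\alpha=\lambda_1^L$ or $\beta=\lambda_1^L$ (in particular, none converging to $(\lambda_1^L,\lambda_1^L)$). This means that the lines $\{\lambda_1^L\}\times\mathbb{R}$ and $\mathbb{R}\times\{\lambda_1^L\}$ are isolated in $\Sigma_L$.
   Context: Let $N\ge 1$ be an integer and let $\Omega\subset\mathbb{R}^N$ be a bounded domain (open and connected) with $C^{1,1}$ boundary. $\|\cdot\|_2$ is the $L^2(\Omega)$ norm; $u^\pm=\max\{\pm u,0\}$, so $u=u^+-u^-$. Put $c_N=\pi^{-N/2}\Gamma(N/2)$ and $\rho_N=2\ln 2+\psi(N/2)-\gamma$, with $\psi=\Gamma'/\Gamma$ the digamma function and $\gamma=-\Gamma'(1)$; $B_1$ is the unit ball centred at $0$, $k(z)=\mathbf 1_{B_1}(z)|z|^{-N}$, $j(z)=\mathbf 1_{\mathbb{R}^N\setminus B_1}(z)|z|^{-N}$ for $z\neq 0$. $\mathbb{H}(\Omega)$ is the Hilbert space of all $u\in L^2(\Omega)$, extended by $u=0$ in $\mathbb{R}^N\setminus\Omega$, with $\iint_{\mathbb{R}^{2N}}|u(x)-u(y)|^2k(x-y)\,dx\,dy<\infty$, with inner product $\mathcal{E}(u,v)=\frac{c_N}{2}\iint_{\mathbb{R}^{2N}}(u(x)-u(y))(v(x)-v(y))k(x-y)\,dx\,dy$. The quadratic form of the logarithmic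 Laplacian $L_\Delta$ (the operator with Fourier symbol $2\ln|\xi|$) is $$\mathcal{E}_L(u,v)=\mathcal{E}(u,v)-c_N\iint_{\mathbb{R}^{2N}}u(x)v(y)j(x-y)\,dx\,dy+\rho_N\int_{\mathbb{R}^N}uv\,dx .$$ The Fučík spectrum $\Sigma_L$ is the set of $(\alpha,\beta)\in\mathbb{R}^2$ for which there is a nontrivial $u\in\mathbb{H}(\Omega)$ with $\mathcal{E}_L(u,v)=\int_\Omega(\alpha u^+-\beta u^-)v\,dx$ for all $v\in\mathbb{H}(\Omega)$ (i.e. a nontrivial weak solution of $L_\Delta u=\alpha u^+-\beta u^-$ in $\Omega$, $u=0$ in $\mathbb{R}^N\setminus\Omega$). The first eigenvalue is $\lambda_1^L=\min\{\mathcal{E}_L(u,u):u\in\mathbb{H}(\Omega),\|u\|_2=1\}$. Here "isolated in $\Sigma_L$" has the meaning expressed by the first sentence of the claim. *)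

theory Defs
  imports "HOL-Analysis.Analysis"
begin

text \<open>
  The space \<open>\<real>\<^sup>N\<close> is an arbitrary type of class \<^class>\<open>euclidean_space\<close>, with \<open>N = DIM('a) \<ge> 1\<close>.
  Elements of \<open>L\<^sup>2\<close> are represented by Borel functions on the whole space; every class has such a
  representative, and ``nontrivial'' accordingly means ``not zero almost everywhere''.
\<close>

text \<open>
  Near each boundary point, \<open>\<Omega>\<close> is the part of a ball lying strictly on one side of the graph of a
  \<open>C\<^sup>1\<^sup>,\<^sup>1\<close> function of \<open>N - 1\<close> variables. The graph direction is a unit vector \<open>\<nu>\<close>, and a function
  on the hyperplane orthogonal to \<open>\<nu>\<close> is encoded as a function on the whole space that is
  invariant under translations along \<open>\<nu>\<close>.
\<close>

definition C11_function :: "('a::euclidean_space \<Rightarrow> real) \<Rightarrow> bool" where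
  "C11_function g \<longleftrightarrow>
     (\<exists>G L. (\<forall>x. GDERIV g x :> G x) \<and> L-lipschitz_on UNIV G)"

definition C11_boundary :: "'a::euclidean_space set \<Rightarrow> bool" where
  "C11_boundary \<Omega> \<longleftrightarrow>
     (\<forall>x0\<in>frontier \<Omega>. \<exists>r>0. \<exists>\<nu> g. norm \<nu> = 1 \<and> C11_function g \<and>
        (\<forall>x t. g (x + t *\<^sub>R \<nu>) = g x) \<and>
        \<Omega> \<inter> ball x0 r = {x \<in> ball x0 r. g x < x \<bullet> \<nu>})"

definition c_const :: "'a::euclidean_space itself \<Rightarrow> real" where
  "c_const _ = pi powr (- (real DIM('a) / 2)) * Gamma (real DIM('a) / 2)"

definition rho_const :: "'a::euclidean_space itself \<Rightarrow> real" where
  "rho_const _ = 2 * ln 2 + Digamma (real DIM('a) / 2) - euler_mascheroni"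

text \<open>The library functions used in \<^const>\<open>rho_const\<close> are \<open>\<psi> = \<Gamma>'/\<Gamma>\<close> and \<open>\<gamma> = -\<Gamma>'(1)\<close>.\<close>

lemma Digamma_eq_deriv_Gamma:
  fixes x :: real
  assumes "x > 0"
  shows "Digamma x = deriv Gamma x / Gamma x"
proof -
  have "x \<notin> \<int>\<^sub>\<le>\<^sub>0" using assms by (auto elim!: nonpos_Ints_cases)
  hence "deriv Gamma x = Gamma x * Digamma x"
    by (intro DERIV_imp_deriv has_field_derivative_Gamma)
  with Gamma_real_pos[OF assms] show ?thesis by simp
qed

lemma euler_mascheroni_eq_deriv_Gamma: "(euler_mascheroni :: real) = - deriv Gamma 1"
  using Digamma_eq_deriv_Gamma[of 1] by simp

definition k_kernel :: "'a::euclidean_space \<Rightarrow> real" where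
  "k_kernel z = indicator (ball 0 1) z / norm z ^ DIM('a)"

definition j_kernel :: "'a::euclidean_space \<Rightarrow> real" where
  "j_kernel z = indicator (- ball 0 1) z / norm z ^ DIM('a)"

definition pos_part :: "('a \<Rightarrow> real) \<Rightarrow> 'a \<Rightarrow> real" where
  "pos_part u x = max (u x) 0"

definition neg_part :: "('a \<Rightarrow> real) \<Rightarrow> 'a \<Rightarrow> real" where
  "neg_part u x = max (- u x) 0"

definition L2_norm_on :: "'a::euclidean_space set \<Rightarrow> ('a \<Rightarrow> real) \<Rightarrow> real" where
  "L2_norm_on \<Omega> u = sqrt (LINT x:\<Omega>|lborel. (u x)\<^sup>2)"

definition H_space :: "'a::euclidean_space set \<Rightarrow> ('a \<Rightarrow> real) set" where
  "H_space \<Omega> = {u \<in> borel_measurable borel.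
     set_integrable lborel \<Omega> (\<lambda>x. (u x)\<^sup>2) \<and>
     (\<forall>x. x \<notin> \<Omega> \<longrightarrow> u x = 0) \<and>
     (\<integral>\<^sup>+(x, y). ennreal (\<bar>u x - u y\<bar>\<^sup>2 * k_kernel (x - y)) \<partial>(lborel \<Otimes>\<^sub>M lborel)) < \<infinity>}"

definition E_form :: "('a::euclidean_space \<Rightarrow> real) \<Rightarrow> ('a \<Rightarrow> real) \<Rightarrow> real" where
  "E_form u v = c_const TYPE('a) / 2 *
     (LINT (x, y)|(lborel \<Otimes>\<^sub>M lborel). (u x - u y) * (v x - v y) * k_kernel (x - y))"

definition E_L :: "('a::euclidean_space \<Rightarrow> real) \<Rightarrow> ('a \<Rightarrow> real) \<Rightarrow> real" where
  "E_L u v = E_form u v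
     - c_const TYPE('a) * (LINT (x, y)|(lborel \<Otimes>\<^sub>M lborel). u x * v y * j_kernel (x - y))
     + rho_const TYPE('a) * (LINT x|lborel. u x * v x)"

definition fucik_spectrum :: "'a::euclidean_space set \<Rightarrow> (real \<times> real) set" where
  "fucik_spectrum \<Omega> = {(\<alpha>, \<beta>). \<exists>u\<in>H_space \<Omega>. \<not> (AE x in lborel. u x = 0) \<and>
     (\<forall>v\<in>H_space \<Omega>.
        E_L u v = (LINT x:\<Omega>|lborel. (\<alpha> * pos_part u x - \<beta> * neg_part u x) * v x))}"

text \<open>On a linear order, \<^const>\<open>Least\<close> is the minimum of the set described by its predicate.\<close>

definition first_eigenvalue :: "'a::euclidean_space set \<Rightarrow> real" where
  "first_eigenvalue \<Omega> = (LEAST c. c \<in> {E_L u u |u. u \<in> H_space \<Omega> \<and> L2_norm_on \<Omega> u = 1})"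

end

theory Submission imports Defs begin

text \<open>
  Let \<open>\<mu>\<close> be the first eigenvalue, \<open>u\<close> a nontrivial weak solution for \<open>(a, b)\<close> with \<open>a, b > \<mu>\<close>,
  and \<open>p\<close>, \<open>n\<close> its positive and negative part. The plan is to bound \<open>(a - \<mu>) (b - \<mu>)\<close> from below
  by a positive constant that depends only on an upper bound for \<open>a\<close> and \<open>b\<close>. Along a convergent
  sequence this product would have to tend to zero as soon as one limit equals \<open>\<mu>\<close>.

  Testing the equation with \<open>p\<close> and with \<open>n\<close> gives \<open>E_L p p = a \<parallel>p\<parallel>\<^sup>2 + E_L p n\<close> and
  \<open>E_L n n = b \<parallel>n\<parallel>\<^sup>2 + E_L p n\<close>, and both left-hand sides are at least \<open>\<mu>\<close> times the squared norm.
  Two estimates then do the work.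

  \<^item> Interaction (\<open>separated_interaction\<close>). The near kernel \<open>k\<close> and the far kernel \<open>j\<close> add up to
    \<open>|z|\<^sup>-\<^sup>N\<close>, which is bounded away from zero for differences of points of a bounded set. Hence
    nonnegative functions with disjoint supports satisfy \<open>E_L p n \<le> - d (\<integral>p) (\<integral>n)\<close>, and so
    \<open>d (\<integral>p) (\<integral>n)\<close> is at most \<open>(a - \<mu>) \<parallel>p\<parallel>\<^sup>2\<close> and at most \<open>(b - \<mu>) \<parallel>n\<parallel>\<^sup>2\<close>.

  \<^item> Reverse Hoelder inequality (\<open>reverse_Hoelder\<close>). The kernel \<open>k\<close> is not integrable at the origin,
    so concentration costs unbounded energy: nonnegative \<open>w\<close> with \<open>E_L w w \<le> B \<parallel>w\<parallel>\<^sup>2\<close> satisfy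
    \<open>e \<parallel>w\<parallel>\<^sup>2 \<le> (\<integral>w)\<^sup>2\<close>, where \<open>e > 0\<close> depends on \<open>B\<close> only.

  Multiplying the two upper bounds and inserting the reverse Hoelder inequality gives
  \<open>(d e)\<^sup>2 \<le> (a - \<mu>) (b - \<mu>)\<close>, once \<open>\<parallel>p\<parallel>\<close> and \<open>\<parallel>n\<parallel>\<close> are cancelled (\<open>fucik_hyperbola\<close>).
  They are positive because \<open>u\<close> changes sign: a nonnegative \<open>u\<close>, tested with a nonnegative ground
  state \<open>\<phi>\<close>, would give \<open>(a - \<mu>) \<integral>u \<phi> = 0\<close>, so \<open>u\<close> and \<open>\<phi>\<close> would have disjoint supports and
  \<open>E_L u \<phi> < 0\<close> by the interaction estimate, although \<open>E_L u \<phi> = a \<integral>u \<phi> = 0\<close>.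

  It remains to see that the minimum defining \<open>\<mu>\<close> is attained (\<open>ground_state_exists\<close>). The same two
  estimates show that a minimizing sequence of nonnegative normalized functions is Cauchy: by the
  parallelogram identity the difference \<open>w\<close> of two almost minimizers has almost no energy above
  \<open>\<mu> \<parallel>w\<parallel>\<^sup>2\<close>, but if \<open>w\<close> is not small, neither its positive nor its negative part is small, and then
  their interaction alone contributes a fixed amount. Completeness of the energy space supplies
  the limit.
\<close>

section \<open>Kernels and auxiliary integration facts\<close>

lemma k_kernel_measurable [measurable]: "k_kernel \<in> borel_measurable borel"
  unfolding k_kernel_def
  by (intro borel_measurable_divide borel_measurable_indicator borel_measurable_power) auto

lemma j_kernel_measurable [measurable]: "j_kernel \<in> borel_measurable borel"
  unfolding j_kernel_def
  by (intro borel_measurable_divide borel_measurable_indicator borel_measurable_power) auto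

lemma k_kernel_nonneg [simp]: "0 \<le> k_kernel z"
  by (simp add: k_kernel_def)

lemma j_kernel_nonneg [simp]: "0 \<le> j_kernel z"
  by (simp add: j_kernel_def)

lemma j_kernel_le_1: "j_kernel z \<le> 1"
  by (auto simp: j_kernel_def indicator_def divide_le_eq)

lemma j_kernel_commute: "j_kernel (x - y) = j_kernel (y - x)"
  by (simp add: j_kernel_def indicator_def norm_minus_commute)

lemma c_const_pos: "0 < c_const TYPE('a::euclidean_space)"
  by (simp add: c_const_def)

text \<open>The requirement of a finite energy double integral becomes Bochner integrability, so
  that closure of the space under algebraic operations reduces to closure of integrability.\<close>
lemma H_space_iff:
  assumes "\<Omega> \<in> sets borel"
  shows "u \<in> H_space \<Omega> \<longleftrightarrow> u \<in> borel_measurable borel \<and> integrable lborel (\<lambda>x. (u x)\<^sup>2) \<and>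
     (\<forall>x. x \<notin> \<Omega> \<longrightarrow> u x = 0) \<and>
     integrable (lborel \<Otimes>\<^sub>M lborel) (\<lambda>(x, y). (u x - u y)\<^sup>2 * k_kernel (x - y))"
proof -
  have *: "set_integrable lborel \<Omega> (\<lambda>x. (u x)\<^sup>2) \<longleftrightarrow> integrable lborel (\<lambda>x. (u x)\<^sup>2)"
    if "\<forall>x. x \<notin> \<Omega> \<longrightarrow> u x = 0"
    unfolding set_integrable_def using that
    by (intro arg_cong[where f="integrable lborel"]) (auto simp: indicator_def fun_eq_iff)
  have **: "(\<integral>\<^sup>+(x, y). ennreal (\<bar>u x - u y\<bar>\<^sup>2 * k_kernel (x - y)) \<partial>(lborel \<Otimes>\<^sub>M lborel)) < \<infinity>
     \<longleftrightarrow> integrable (lborel \<Otimes>\<^sub>M lborel) (\<lambda>(x, y). (u x - u y)\<^sup>2 * k_kernel (x - y))"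
    if [measurable]: "u \<in> borel_measurable borel"
    by (subst integrable_iff_bounded) (simp add: case_prod_beta')
  show ?thesis unfolding H_space_def using * ** by auto
qed

lemma integrable_tensor:
  fixes f g :: "'a::euclidean_space \<Rightarrow> real"
  assumes f: "integrable lborel f" and g: "integrable lborel g"
  shows "integrable (lborel \<Otimes>\<^sub>M lborel) (\<lambda>(x, y). f x * g y)"
    and "(LINT (x, y)|(lborel \<Otimes>\<^sub>M lborel). f x * g y) = (LINT x|lborel. f x) * (LINT x|lborel. g x)"
proof -
  have [measurable]: "f \<in> borel_measurable borel" "g \<in> borel_measurable borel"
    using f g by (auto dest: borel_measurable_integrable)
  show *: "integrable (lborel \<Otimes>\<^sub>M lborel) (\<lambda>(x, y). f x * g y)"
    by (rule lborel_pair.Fubini_integrable) (use f g in \<open>auto simp: abs_mult\<close>)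
  show "(LINT (x, y)|(lborel \<Otimes>\<^sub>M lborel). f x * g y) = (LINT x|lborel. f x) * (LINT x|lborel. g x)"
    using lborel_pair.integral_fst'[OF *] by simp
qed

lemma AE_lborel_fst_snd:
  assumes "AE x in lborel. Q (x::'a::euclidean_space)"
  shows "AE p in lborel \<Otimes>\<^sub>M (lborel :: 'a measure). Q (fst p) \<and> Q (snd p)"
proof -
  obtain N where N: "{x \<in> space lborel. \<not> Q x} \<subseteq> N" "N \<in> sets lborel" "emeasure lborel N = 0"
    using AE_E[OF assms] by metis
  then have [measurable]: "N \<in> sets borel" by simp
  have AE: "AE x in lborel. x \<notin> N" using N by (intro AE_not_in) auto
  have "AE p in lborel \<Otimes>\<^sub>M (lborel :: 'a measure). fst p \<notin> N"
  proof (rule lborel_pair.AE_pair_measure)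
    show "{p \<in> space (lborel \<Otimes>\<^sub>M lborel). fst p \<notin> N} \<in> sets (lborel \<Otimes>\<^sub>M (lborel :: 'a measure))"
      by measurable
  qed (use AE in auto)
  moreover have "AE p in lborel \<Otimes>\<^sub>M (lborel :: 'a measure). snd p \<notin> N"
  proof (rule lborel_pair.AE_pair_measure)
    show "{p \<in> space (lborel \<Otimes>\<^sub>M lborel). snd p \<notin> N} \<in> sets (lborel \<Otimes>\<^sub>M (lborel :: 'a measure))"
      by measurable
  qed (use AE in auto)
  ultimately show ?thesis by eventually_elim (use N(1) in auto)
qed

lemma mult_abs_le_squares: "\<bar>a * b\<bar> \<le> a\<^sup>2 + (b::real)\<^sup>2"
proof -
  have "0 \<le> (\<bar>a\<bar> - \<bar>b\<bar>)\<^sup>2" by simp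
  hence "2 * \<bar>a * b\<bar> \<le> a\<^sup>2 + b\<^sup>2" by (simp add: power2_diff abs_mult)
  moreover have "0 \<le> \<bar>a * b\<bar>" by simp
  ultimately show ?thesis by linarith
qed

text \<open>The discriminant argument: the square of \<open>s f + t g\<close> has nonnegative integral for all
  \<open>s\<close>, \<open>t\<close>. The choice \<open>s = \<integral>g\<^sup>2\<close>, \<open>t = - \<integral>f g\<close> gives the claim up to the factor \<open>\<integral>g\<^sup>2\<close>.\<close>
lemma integral_Cauchy_Schwarz:
  fixes f g :: "'b \<Rightarrow> real"
  assumes "integrable M (\<lambda>x. (f x)\<^sup>2)" "integrable M (\<lambda>x. (g x)\<^sup>2)" "integrable M (\<lambda>x. f x * g x)"
  shows "(LINT x|M. f x * g x)\<^sup>2 \<le> (LINT x|M. (f x)\<^sup>2) * (LINT x|M. (g x)\<^sup>2)"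
proof -
  define A B C where "A = (LINT x|M. (f x)\<^sup>2)" "B = (LINT x|M. (g x)\<^sup>2)" "C = (LINT x|M. f x * g x)"
  have q: "0 \<le> s\<^sup>2 * A + 2 * (s * t) * C + t\<^sup>2 * B" for s t
  proof -
    have "0 \<le> (LINT x|M. (s * f x + t * g x)\<^sup>2)" by simp
    also have "\<dots> = (LINT x|M. s\<^sup>2 * (f x)\<^sup>2 + 2 * (s * t) * (f x * g x) + t\<^sup>2 * (g x)\<^sup>2)"
      by (rule Bochner_Integration.integral_cong) (auto simp: power2_eq_square algebra_simps)
    also have "\<dots> = s\<^sup>2 * A + 2 * (s * t) * C + t\<^sup>2 * B"
      using assms by (simp add: A_B_C_def)
    finally show ?thesis .
  qed
  have A: "0 \<le> A" and B: "0 \<le> B" by (auto simp: A_B_C_def)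
  show ?thesis unfolding A_B_C_def[symmetric]
  proof (cases "B = 0")
    case True
    have "C = 0"
    proof (rule ccontr)
      assume "C \<noteq> 0"
      then show False using q[of 1 "- (A + 1) / (2 * C)"] True by (simp add: field_simps)
    qed
    then show "C\<^sup>2 \<le> A * B" using A B by simp
  next
    case False
    have "0 \<le> B * (A * B - C\<^sup>2)" using q[of B "- C"] by (simp add: power2_eq_square algebra_simps)
    then show "C\<^sup>2 \<le> A * B" using False B by (simp add: zero_le_mult_iff)
  qed
qed

section \<open>The energy space and the quadratic form\<close>

locale log_laplacian_domain =
  fixes \<Omega> :: "'a::euclidean_space set"
  assumes borel_domain: "\<Omega> \<in> sets borel" and bounded_domain: "bounded \<Omega>"
begin

definition mass :: "('a \<Rightarrow> real) \<Rightarrow> real" where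
  "mass u = (LINT x|lborel. u x)"

definition L2_inner :: "('a \<Rightarrow> real) \<Rightarrow> ('a \<Rightarrow> real) \<Rightarrow> real" where
  "L2_inner u v = (LINT x|lborel. u x * v x)"

abbreviation H :: "('a \<Rightarrow> real) set" where "H \<equiv> H_space \<Omega>"

lemma H_measurable: "u \<in> H \<Longrightarrow> u \<in> borel_measurable borel"
  using borel_domain by (simp add: H_space_iff)

lemma H_outside: "u \<in> H \<Longrightarrow> x \<notin> \<Omega> \<Longrightarrow> u x = 0"
  using borel_domain by (simp add: H_space_iff)

lemma H_integrable_square: "u \<in> H \<Longrightarrow> integrable lborel (\<lambda>x. (u x)\<^sup>2)"
  using borel_domain by (simp add: H_space_iff)

lemma H_integrable_form_diag:
  "u \<in> H \<Longrightarrow> integrable (lborel \<Otimes>\<^sub>M lborel) (\<lambda>(x, y). (u x - u y)\<^sup>2 * k_kernel (x - y))"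
  using borel_domain by (simp add: H_space_iff)

lemma H_integrable_mult:
  assumes "u \<in> H" "v \<in> H"
  shows "integrable lborel (\<lambda>x. u x * v x)"
proof (rule Bochner_Integration.integrable_bound)
  show "integrable lborel (\<lambda>x. (u x)\<^sup>2 + (v x)\<^sup>2)"
    using assms by (intro Bochner_Integration.integrable_add H_integrable_square)
  note [measurable] = assms[THEN H_measurable]
  show "(\<lambda>x. u x * v x) \<in> borel_measurable lborel" by measurable
  show "AE x in lborel. norm (u x * v x) \<le> norm ((u x)\<^sup>2 + (v x)\<^sup>2)"
    using mult_abs_le_squares by (intro AE_I2) simp
qed

lemma integrable_domain: "integrable lborel (indicator \<Omega> :: 'a \<Rightarrow> real)"
  using borel_domain bounded_domain emeasure_bounded_finite[OF bounded_domain]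
  by (intro integrable_real_indicator) auto

lemma H_integrable:
  assumes "u \<in> H"
  shows "integrable lborel u"
proof (rule Bochner_Integration.integrable_bound)
  show "integrable lborel (\<lambda>x. indicator \<Omega> x + (u x)\<^sup>2)"
    using assms by (intro Bochner_Integration.integrable_add H_integrable_square integrable_domain)
  show "u \<in> borel_measurable lborel" using H_measurable[OF assms] by simp
  have "\<bar>u x\<bar> \<le> indicator \<Omega> x + (u x)\<^sup>2" for x
    using mult_abs_le_squares[of "u x" 1] H_outside[OF assms, of x] by (auto simp: indicator_def)
  then show "AE x in lborel. norm (u x) \<le> norm (indicator \<Omega> x + (u x)\<^sup>2)"
    by (intro AE_I2) (simp add: add_nonneg_nonneg)
qed

lemma H_integrable_form:
  assumes "u \<in> H" "v \<in> H"
  shows "integrable (lborel \<Otimes>\<^sub>M lborel) (\<lambda>(x, y). (u x - u y) * (v x - v y) * k_kernel (x - y))"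
proof (rule Bochner_Integration.integrable_bound)
  note [measurable] = assms[THEN H_measurable]
  show "integrable (lborel \<Otimes>\<^sub>M lborel) (\<lambda>p. (\<lambda>(x, y). (u x - u y)\<^sup>2 * k_kernel (x - y)) p +
          (\<lambda>(x, y). (v x - v y)\<^sup>2 * k_kernel (x - y)) p)"
    using assms by (intro Bochner_Integration.integrable_add H_integrable_form_diag)
  show "(\<lambda>(x, y). (u x - u y) * (v x - v y) * k_kernel (x - y)) \<in> borel_measurable (lborel \<Otimes>\<^sub>M lborel)"
    by measurable
  have "\<bar>a * b * K\<bar> \<le> \<bar>a\<^sup>2 * K + b\<^sup>2 * K\<bar>" if "0 \<le> K" for a b K :: real
    using mult_right_mono[OF mult_abs_le_squares[of a b] that] that
    by (simp add: abs_mult distrib_right)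
  then show "AE p in lborel \<Otimes>\<^sub>M lborel.
      norm ((\<lambda>(x, y). (u x - u y) * (v x - v y) * k_kernel (x - y)) p) \<le>
      norm ((\<lambda>(x, y). (u x - u y)\<^sup>2 * k_kernel (x - y)) p + (\<lambda>(x, y). (v x - v y)\<^sup>2 * k_kernel (x - y)) p)"
    by (intro AE_I2) (auto simp: case_prod_beta)
qed

lemma H_integrable_far:
  assumes "u \<in> H" "v \<in> H"
  shows "integrable (lborel \<Otimes>\<^sub>M lborel) (\<lambda>(x, y). u x * v y * j_kernel (x - y))"
proof (rule Bochner_Integration.integrable_bound)
  note [measurable] = assms[THEN H_measurable]
  show "integrable (lborel \<Otimes>\<^sub>M lborel) (\<lambda>(x, y). u x * v y)"
    using assms by (intro integrable_tensor H_integrable)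
  show "(\<lambda>(x, y). u x * v y * j_kernel (x - y)) \<in> borel_measurable (lborel \<Otimes>\<^sub>M lborel)"
    by measurable
  show "AE p in lborel \<Otimes>\<^sub>M lborel. norm ((\<lambda>(x, y). u x * v y * j_kernel (x - y)) p)
          \<le> norm ((\<lambda>(x, y). u x * v y) p)"
    using j_kernel_le_1
    by (intro AE_I2) (auto simp: abs_mult intro!: mult_left_le)
qed

lemma H_lincomb:
  assumes "u \<in> H" "v \<in> H"
  shows "(\<lambda>x. s * u x + t * v x) \<in> H"
proof -
  have "integrable lborel (\<lambda>x. s\<^sup>2 * (u x)\<^sup>2 + 2 * s * t * (u x * v x) + t\<^sup>2 * (v x)\<^sup>2)"
    using assms by (intro Bochner_Integration.integrable_add integrable_mult_right H_integrable_square
        H_integrable_mult)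
  moreover have "s\<^sup>2 * (u x)\<^sup>2 + 2 * s * t * (u x * v x) + t\<^sup>2 * (v x)\<^sup>2 = (s * u x + t * v x)\<^sup>2" for x
    by (simp add: power2_eq_square algebra_simps)
  ultimately have 1: "integrable lborel (\<lambda>x. (s * u x + t * v x)\<^sup>2)" by simp
  have "integrable (lborel \<Otimes>\<^sub>M lborel) (\<lambda>p.
      s\<^sup>2 * (\<lambda>(x, y). (u x - u y)\<^sup>2 * k_kernel (x - y)) p +
      2 * s * t * (\<lambda>(x, y). (u x - u y) * (v x - v y) * k_kernel (x - y)) p +
      t\<^sup>2 * (\<lambda>(x, y). (v x - v y)\<^sup>2 * k_kernel (x - y)) p)"
    using assms by (intro Bochner_Integration.integrable_add integrable_mult_right H_integrable_form_diag
        H_integrable_form)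
  moreover have "s\<^sup>2 * (\<lambda>(x, y). (u x - u y)\<^sup>2 * k_kernel (x - y)) p +
      2 * s * t * (\<lambda>(x, y). (u x - u y) * (v x - v y) * k_kernel (x - y)) p +
      t\<^sup>2 * (\<lambda>(x, y). (v x - v y)\<^sup>2 * k_kernel (x - y)) p =
      (\<lambda>(x, y). ((s * u x + t * v x) - (s * u y + t * v y))\<^sup>2 * k_kernel (x - y)) p" for p
    by (simp add: case_prod_beta power2_eq_square algebra_simps)
  ultimately have 2: "integrable (lborel \<Otimes>\<^sub>M lborel)
      (\<lambda>(x, y). ((s * u x + t * v x) - (s * u y + t * v y))\<^sup>2 * k_kernel (x - y))" by simp
  show ?thesis using borel_domain 1 2 assms by (auto simp: H_space_iff)
qed

lemma H_scale: "u \<in> H \<Longrightarrow> (\<lambda>x. s * u x) \<in> H"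
  using H_lincomb[of u u s 0] by simp

lemma H_diff: "u \<in> H \<Longrightarrow> v \<in> H \<Longrightarrow> (\<lambda>x. u x - v x) \<in> H"
  using H_lincomb[of u v 1 "- 1"] by simp

lemma H_add: "u \<in> H \<Longrightarrow> v \<in> H \<Longrightarrow> (\<lambda>x. u x + v x) \<in> H"
  using H_lincomb[of u v 1 1] by simp

text \<open>The form is a Dirichlet form: normal contractions do not increase energy. This is what
  makes positive parts, negative parts and absolute values admissible test functions.\<close>
lemma H_contraction:
  assumes u: "u \<in> H" and g: "\<And>s t. \<bar>g s - g t\<bar> \<le> \<bar>s - t\<bar>" and g0: "g 0 = 0"
    and [measurable]: "g \<in> borel_measurable borel"
  shows "(\<lambda>x. g (u x)) \<in> H"
proof -
  have [measurable]: "u \<in> borel_measurable borel" using u by (rule H_measurable)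
  have "integrable lborel (\<lambda>x. (g (u x))\<^sup>2)"
  proof (rule Bochner_Integration.integrable_bound[OF H_integrable_square[OF u]])
    show "AE x in lborel. norm ((g (u x))\<^sup>2) \<le> norm ((u x)\<^sup>2)"
      using g[of _ 0] g0 by (intro AE_I2) (simp add: abs_le_square_iff)
  qed simp
  moreover have "integrable (lborel \<Otimes>\<^sub>M lborel) (\<lambda>(x, y). (g (u x) - g (u y))\<^sup>2 * k_kernel (x - y))"
  proof (rule Bochner_Integration.integrable_bound[OF H_integrable_form_diag[OF u]])
    show "AE p in lborel \<Otimes>\<^sub>M lborel. norm ((\<lambda>(x, y). (g (u x) - g (u y))\<^sup>2 * k_kernel (x - y)) p)
        \<le> norm ((\<lambda>(x, y). (u x - u y)\<^sup>2 * k_kernel (x - y)) p)"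
      using g by (intro AE_I2) (auto simp: abs_mult abs_le_square_iff[symmetric] intro!: mult_right_mono)
  qed measurable
  ultimately show ?thesis using u borel_domain g0 by (simp add: H_space_iff)
qed

lemma H_pos_part: "u \<in> H \<Longrightarrow> pos_part u \<in> H"
  using H_contraction[of u "\<lambda>s. max s 0"] by (simp add: pos_part_def[abs_def])

lemma H_neg_part: "u \<in> H \<Longrightarrow> neg_part u \<in> H"
  using H_contraction[of u "\<lambda>s. max (- s) 0"] by (simp add: neg_part_def[abs_def])

lemma H_abs: "u \<in> H \<Longrightarrow> (\<lambda>x. \<bar>u x\<bar>) \<in> H"
  using H_contraction[of u "\<lambda>s. \<bar>s\<bar>"] by simp

lemma L2_inner_lincomb_left:
  assumes "u \<in> H" "v \<in> H" "w \<in> H"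
  shows "L2_inner (\<lambda>x. s * u x + t * v x) w = s * L2_inner u w + t * L2_inner v w"
proof -
  have "L2_inner (\<lambda>x. s * u x + t * v x) w = (LINT x|lborel. s * (u x * w x) + t * (v x * w x))"
    unfolding L2_inner_def by (rule Bochner_Integration.integral_cong) (auto simp: algebra_simps)
  also have "\<dots> = s * L2_inner u w + t * L2_inner v w"
    using assms by (simp add: L2_inner_def H_integrable_mult)
  finally show ?thesis .
qed

lemma L2_inner_commute: "L2_inner u v = L2_inner v u"
  by (simp add: L2_inner_def mult.commute)

lemma L2_inner_self: "L2_inner u u = (LINT x|lborel. (u x)\<^sup>2)"
  by (simp add: L2_inner_def power2_eq_square)

lemma L2_inner_self_nonneg: "0 \<le> L2_inner u u"
  by (simp add: L2_inner_self)

lemma E_form_lincomb_left: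
  assumes "u \<in> H" "v \<in> H" "w \<in> H"
  shows "E_form (\<lambda>x. s * u x + t * v x) w = s * E_form u w + t * E_form v w"
proof -
  have "(LINT (x, y)|(lborel \<Otimes>\<^sub>M lborel). (s * u x + t * v x - (s * u y + t * v y)) * (w x - w y) * k_kernel (x - y))
    = (LINT p|(lborel \<Otimes>\<^sub>M lborel). s * (\<lambda>(x, y). (u x - u y) * (w x - w y) * k_kernel (x - y)) p
        + t * (\<lambda>(x, y). (v x - v y) * (w x - w y) * k_kernel (x - y)) p)"
    by (rule Bochner_Integration.integral_cong) (auto simp: algebra_simps)
  also have "\<dots> = s * (LINT (x, y)|(lborel \<Otimes>\<^sub>M lborel). (u x - u y) * (w x - w y) * k_kernel (x - y))
        + t * (LINT (x, y)|(lborel \<Otimes>\<^sub>M lborel). (v x - v y) * (w x - w y) * k_kernel (x - y))"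
    using H_integrable_form[OF assms(1,3)] H_integrable_form[OF assms(2,3)] by simp
  finally show ?thesis by (simp add: E_form_def algebra_simps)
qed

lemma E_form_commute: "E_form u v = E_form v u"
  by (simp add: E_form_def mult.commute mult.left_commute)

lemma E_form_self_nonneg: "0 \<le> E_form u (u :: 'a \<Rightarrow> real)"
  unfolding E_form_def using c_const_pos[where 'a='a]
  by (intro mult_nonneg_nonneg integral_nonneg_AE AE_I2) (auto simp: case_prod_beta)

lemma E_L_commute:
  assumes "u \<in> H" "v \<in> H"
  shows "E_L u v = E_L v u"
proof -
  have "(LINT (x, y)|(lborel \<Otimes>\<^sub>M lborel). u x * v y * j_kernel (x - y)) =
        (LINT (x, y)|(lborel \<Otimes>\<^sub>M lborel). v x * u y * j_kernel (x - y))"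
    using lborel_pair.integral_product_swap[of "\<lambda>(x, y). u x * v y * j_kernel (x - y)"]
      H_integrable_far[OF assms] borel_measurable_integrable
    by (simp add: case_prod_beta mult.commute j_kernel_commute)
  then show ?thesis
    using E_form_commute[of u v] by (simp add: E_L_def mult.commute)
qed

lemma E_L_lincomb_left:
  assumes "u \<in> H" "v \<in> H" "w \<in> H"
  shows "E_L (\<lambda>x. s * u x + t * v x) w = s * E_L u w + t * E_L v w"
proof -
  have "(LINT (x, y)|(lborel \<Otimes>\<^sub>M lborel). (s * u x + t * v x) * w y * j_kernel (x - y))
    = (LINT p|(lborel \<Otimes>\<^sub>M lborel). s * (\<lambda>(x, y). u x * w y * j_kernel (x - y)) p
        + t * (\<lambda>(x, y). v x * w y * j_kernel (x - y)) p)"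
    by (rule Bochner_Integration.integral_cong) (auto simp: algebra_simps)
  also have "\<dots> = s * (LINT (x, y)|(lborel \<Otimes>\<^sub>M lborel). u x * w y * j_kernel (x - y))
        + t * (LINT (x, y)|(lborel \<Otimes>\<^sub>M lborel). v x * w y * j_kernel (x - y))"
    using H_integrable_far[OF assms(1,3)] H_integrable_far[OF assms(2,3)] by simp
  finally show ?thesis
    using E_form_lincomb_left[OF assms, of s t] L2_inner_lincomb_left[OF assms, of s t]
    by (simp add: E_L_def L2_inner_def algebra_simps)
qed

lemma E_L_quadratic:
  assumes "u \<in> H" "v \<in> H"
  shows "E_L (\<lambda>x. s * u x + t * v x) (\<lambda>x. s * u x + t * v x) =
    s\<^sup>2 * E_L u u + 2 * s * t * E_L u v + t\<^sup>2 * E_L v v"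
proof -
  let ?w = "\<lambda>x. s * u x + t * v x"
  have w: "?w \<in> H" using assms by (rule H_lincomb)
  have "E_L ?w ?w = s * E_L u ?w + t * E_L v ?w" by (rule E_L_lincomb_left[OF assms w])
  also have "E_L u ?w = s * E_L u u + t * E_L v u"
    using E_L_lincomb_left[OF assms assms(1)] E_L_commute[OF assms(1) w] by simp
  also have "E_L v ?w = s * E_L u v + t * E_L v v"
    using E_L_lincomb_left[OF assms assms(2)] E_L_commute[OF assms(2) w] by simp
  also have "E_L v u = E_L u v" using assms by (intro E_L_commute)
  finally show ?thesis by (simp add: power2_eq_square algebra_simps)
qed

lemma L2_inner_quadratic:
  assumes "u \<in> H" "v \<in> H"
  shows "L2_inner (\<lambda>x. s * u x + t * v x) (\<lambda>x. s * u x + t * v x) =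
    s\<^sup>2 * L2_inner u u + 2 * s * t * L2_inner u v + t\<^sup>2 * L2_inner v v"
proof -
  let ?w = "\<lambda>x. s * u x + t * v x"
  have w: "?w \<in> H" using assms by (rule H_lincomb)
  have "L2_inner ?w ?w = s * L2_inner u ?w + t * L2_inner v ?w"
    by (rule L2_inner_lincomb_left[OF assms w])
  also have "L2_inner u ?w = s * L2_inner u u + t * L2_inner v u"
    using L2_inner_lincomb_left[OF assms assms(1)] L2_inner_commute[of u ?w] by simp
  also have "L2_inner v ?w = s * L2_inner u v + t * L2_inner v v"
    using L2_inner_lincomb_left[OF assms assms(2)] L2_inner_commute[of v ?w] by simp
  also have "L2_inner v u = L2_inner u v" by (rule L2_inner_commute)
  finally show ?thesis by (simp add: power2_eq_square algebra_simps)
qed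

end

section \<open>Non-integrability of the near kernel\<close>

text \<open>Cutting \<open>k\<close> off at radius \<open>(1/2)\<^sup>n\<close> leaves a bounded kernel whose mass still grows linearly
  in \<open>n\<close>, each dyadic annulus contributing the same amount.\<close>
definition truncated_kernel :: "nat \<Rightarrow> 'a::euclidean_space \<Rightarrow> real" where
  "truncated_kernel n z = indicator (- ball 0 ((1/2) ^ n)) z * k_kernel z"

lemma truncated_kernel_measurable [measurable]: "truncated_kernel n \<in> borel_measurable borel"
  unfolding truncated_kernel_def
  by (intro borel_measurable_times borel_measurable_indicator k_kernel_measurable) auto

lemma truncated_kernel_nonneg: "0 \<le> truncated_kernel n z"
  by (simp add: truncated_kernel_def)

lemma truncated_kernel_le_k: "truncated_kernel n z \<le> k_kernel z"
  by (auto simp: truncated_kernel_def indicator_def)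

lemma truncated_kernel_le: "truncated_kernel n (z::'a::euclidean_space) \<le> 2 ^ (n * DIM('a))"
proof (cases "norm z < (1/2) ^ n \<or> 1 \<le> norm z")
  case True
  then show ?thesis by (auto simp: truncated_kernel_def k_kernel_def indicator_def)
next
  case False
  have pos: "0 < ((1/2 :: real) ^ n) ^ DIM('a)" for n :: nat by simp
  have "0 < (1/2 :: real) ^ n" by simp
  then have z: "0 < norm z" using False by linarith
  have "((1/2) ^ n) ^ DIM('a) \<le> norm z ^ DIM('a)"
    using False by (intro power_mono) auto
  then have "1 / norm z ^ DIM('a) \<le> 1 / ((1/2) ^ n) ^ DIM('a)"
    by (intro divide_left_mono) (use pos[of n] z in \<open>auto intro!: mult_pos_pos\<close>)
  also have "\<dots> = 2 ^ (n * DIM('a))" by (simp add: power_mult power_one_over)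
  finally show ?thesis using False by (auto simp: truncated_kernel_def k_kernel_def indicator_def)
qed

text \<open>On the annulus between \<open>r/2\<close> and \<open>r\<close> the kernel is at least \<open>r\<^sup>-\<^sup>N\<close>, while the annulus has
  volume \<open>r\<^sup>N\<close> times the constant \<open>\<omega>\<close>. The powers of \<open>r\<close> cancel.\<close>
lemma nn_integral_truncated_kernel_ge:
  fixes x :: "'a::euclidean_space"
  defines "\<omega> \<equiv> unit_ball_vol DIM('a) * (1 - (1/2) ^ DIM('a))"
  shows "ennreal (real n * \<omega>) \<le> (\<integral>\<^sup>+y. ennreal (truncated_kernel n (x - y)) \<partial>lborel)"
proof (induction n)
  case (Suc n)
  define r :: real where "r = (1/2) ^ n"
  have r: "0 < r" "r \<le> 1" by (auto simp: r_def power_le_one)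
  define A where "A = ball x r - ball x (r/2)"
  have \<omega>: "0 \<le> \<omega>" unfolding \<omega>_def by (intro mult_nonneg_nonneg) (auto simp: power_le_one)
  have A [measurable]: "A \<in> sets borel" by (simp add: A_def)
  have "emeasure lborel A = emeasure lborel (ball x r) - emeasure lborel (ball x (r/2))"
    unfolding A_def using r by (intro emeasure_Diff) (auto simp: emeasure_ball)
  also have "\<dots> = ennreal (r ^ DIM('a) * \<omega>)"
    using r by (simp add: emeasure_ball \<omega>_def ennreal_minus power_divide algebra_simps power_one_over)
  finally have eA: "emeasure lborel A = ennreal (r ^ DIM('a) * \<omega>)" .
  have "ennreal (real (Suc n) * \<omega>) = ennreal (real n * \<omega>) + ennreal \<omega>"
    using \<omega> by (simp add: distrib_right add.commute flip: ennreal_plus)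
  also have "ennreal \<omega> = (\<integral>\<^sup>+y. ennreal (1 / r ^ DIM('a)) * indicator A y \<partial>lborel)"
    using r \<omega> by (subst nn_integral_cmult_indicator) (auto simp: eA simp flip: ennreal_mult)
  also have "ennreal (real n * \<omega>) + (\<integral>\<^sup>+y. ennreal (1 / r ^ DIM('a)) * indicator A y \<partial>lborel) \<le>
      (\<integral>\<^sup>+y. ennreal (truncated_kernel n (x - y)) \<partial>lborel) +
      (\<integral>\<^sup>+y. ennreal (1 / r ^ DIM('a)) * indicator A y \<partial>lborel)"
    by (intro add_right_mono Suc.IH)
  also have "\<dots> = (\<integral>\<^sup>+y. ennreal (truncated_kernel n (x - y)) +
      ennreal (1 / r ^ DIM('a)) * indicator A y \<partial>lborel)"
    by (intro nn_integral_add[symmetric]) auto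
  also have "\<dots> \<le> (\<integral>\<^sup>+y. ennreal (truncated_kernel (Suc n) (x - y)) \<partial>lborel)"
  proof (rule nn_integral_mono)
    fix y
    consider "y \<in> A" | "y \<notin> A" "norm (x - y) < r" | "y \<notin> A" "r \<le> norm (x - y)" by linarith
    then show "ennreal (truncated_kernel n (x - y)) + ennreal (1 / r ^ DIM('a)) * indicator A y
        \<le> ennreal (truncated_kernel (Suc n) (x - y))"
    proof cases
      case 1
      then have *: "norm (x - y) < r" "r / 2 \<le> norm (x - y)" by (auto simp: A_def dist_norm)
      then have "0 < norm (x - y)" using r by linarith
      then have "1 / r ^ DIM('a) \<le> 1 / norm (x - y) ^ DIM('a)"
        using * r by (intro divide_left_mono power_mono mult_pos_pos zero_less_power) auto
      then show ?thesis using * 1 r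
        by (auto simp: truncated_kernel_def k_kernel_def r_def[symmetric] indicator_def)
    next
      case 2
      then show ?thesis using r by (auto simp: truncated_kernel_def r_def[symmetric] indicator_def)
    next
      case 3
      then show ?thesis using r by (auto simp: truncated_kernel_def r_def[symmetric] indicator_def)
    qed
  qed
  finally show ?case .
qed simp

section \<open>The two basic estimates\<close>

context log_laplacian_domain
begin

lemma mass_nonneg: "AE x in lborel. 0 \<le> u x \<Longrightarrow> 0 \<le> mass u"
  unfolding mass_def by (rule integral_nonneg_AE)

text \<open>If \<open>p n = 0\<close>, then \<open>(p x - p y) (n x - n y) = - p x n y - p y n x\<close>, so the near part and the
  far part of the form both have the sign of \<open>- p x n y\<close>; the zeroth order term vanishes. On
  \<open>\<Omega> \<times> \<Omega>\<close> off the diagonal one of the two kernels is at least the inverse \<open>N\<close>-th power of a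
  bound for the diameter. Nonnegativity and disjointness are only asked for almost everywhere
  because the estimate is later applied to weak solutions.\<close>
lemma separated_interaction:
  obtains d where "d > 0"
    "\<And>p n. p \<in> H \<Longrightarrow> n \<in> H \<Longrightarrow> AE x in lborel. 0 \<le> p x \<Longrightarrow> AE x in lborel. 0 \<le> n x \<Longrightarrow>
       AE x in lborel. p x * n x = 0 \<Longrightarrow> E_L p n \<le> - d * (mass p * mass n)"
proof -
  obtain S where S: "\<And>x. x \<in> \<Omega> \<Longrightarrow> norm x \<le> S" "0 < S"
    using bounded_domain by (auto simp: bounded_pos)
  define R where "R = max 1 (2 * S)"
  define \<delta> where "\<delta> = 1 / R ^ DIM('a)"
  have R: "1 \<le> R" by (simp add: R_def)
  have \<delta>: "0 < \<delta>" using R by (simp add: \<delta>_def)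
  have kernel: "\<delta> \<le> k_kernel (x - y) + 2 * j_kernel (x - y)" if "x \<in> \<Omega>" "y \<in> \<Omega>" "x \<noteq> y" for x y
  proof -
    have "norm (x - y) \<le> R"
      using S(1)[OF that(1)] S(1)[OF that(2)] norm_triangle_ineq4[of x y] by (auto simp: R_def)
    then have "\<delta> \<le> 1 / norm (x - y) ^ DIM('a)"
      using that R unfolding \<delta>_def by (intro divide_left_mono power_mono mult_pos_pos zero_less_power) auto
    also have "\<dots> \<le> k_kernel (x - y) + 2 * j_kernel (x - y)"
      by (auto simp: k_kernel_def j_kernel_def indicator_def intro!: divide_right_mono)
    finally show ?thesis .
  qed
  define c where "c = c_const TYPE('a)"
  have c: "0 < c" by (simp add: c_def c_const_pos)
  show thesis
  proof (rule that[of "c / 2 * \<delta>"])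
    show "0 < c / 2 * \<delta>" using c \<delta> by simp
    fix p n
    assume pn: "p \<in> H" "n \<in> H" and p0: "AE x in lborel. 0 \<le> p x" and n0: "AE x in lborel. 0 \<le> n x"
      and pn0: "AE x in lborel. p x * n x = 0"
    note [measurable] = pn[THEN H_measurable]
    let ?P = "lborel \<Otimes>\<^sub>M lborel :: ('a \<times> 'a) measure"
    let ?f = "\<lambda>(x, y). (p x - p y) * (n x - n y) * k_kernel (x - y)"
    let ?g = "\<lambda>(x, y). p x * n y * j_kernel (x - y)"
    let ?h = "\<lambda>(x, y). p x * n y"
    have f: "integrable ?P ?f" and g: "integrable ?P ?g" and h: "integrable ?P ?h"
      using pn by (auto intro: H_integrable_form H_integrable_far integrable_tensor H_integrable)
    have "(LINT x|lborel. p x * n x) = (LINT x|(lborel :: 'a measure). 0)"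
      by (rule integral_cong_AE) (use pn0 in auto)
    then have "E_L p n = c / 2 * ((LINT z|?P. ?f z) - 2 * (LINT z|?P. ?g z))"
      by (simp add: E_L_def E_form_def c_def algebra_simps)
    also have "(LINT z|?P. ?f z) - 2 * (LINT z|?P. ?g z) = (LINT z|?P. ?f z - 2 * ?g z)"
      using f g by simp
    also have "\<dots> \<le> (LINT z|?P. - \<delta> * ?h z)"
    proof (rule integral_mono_AE)
      show "integrable ?P (\<lambda>z. ?f z - 2 * ?g z)" using f g by simp
      show "integrable ?P (\<lambda>z. - \<delta> * ?h z)" using h by (intro integrable_mult_right)
      have "AE z in ?P. 0 \<le> p (fst z) \<and> 0 \<le> p (snd z) \<and> 0 \<le> n (fst z) \<and> 0 \<le> n (snd z) \<and>
          p (fst z) * n (fst z) = 0 \<and> p (snd z) * n (snd z) = 0"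
        using AE_lborel_fst_snd[OF p0] AE_lborel_fst_snd[OF n0] AE_lborel_fst_snd[OF pn0]
        by eventually_elim auto
      then show "AE z in ?P. ?f z - 2 * ?g z \<le> - \<delta> * ?h z"
      proof eventually_elim
        case (elim z)
        define x y where "x = fst z" "y = snd z"
        have xy: "0 \<le> p x" "0 \<le> p y" "0 \<le> n x" "0 \<le> n y" "p x * n x = 0" "p y * n y = 0"
          using elim by (auto simp: x_y_def)
        have "\<delta> * (p x * n y) \<le> (k_kernel (x - y) + 2 * j_kernel (x - y)) * (p x * n y)"
        proof (cases "x \<in> \<Omega> \<and> y \<in> \<Omega> \<and> x \<noteq> y")
          case True
          then show ?thesis using xy kernel by (intro mult_right_mono) auto
        next
          case False
          then have "p x * n y = 0" using xy H_outside[OF pn(1)] H_outside[OF pn(2)] by auto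
          then show ?thesis by auto
        qed
        moreover have "(p x - p y) * (n x - n y) = - (p x * n y) - p y * n x"
          using xy(5,6) by (simp only: left_diff_distrib right_diff_distrib)
        then have "(p x - p y) * (n x - n y) * k_kernel (x - y) =
            - (p x * n y) * k_kernel (x - y) - p y * n x * k_kernel (x - y)"
          by (simp only: left_diff_distrib)
        moreover have "0 \<le> p y * n x * k_kernel (x - y)" using xy by simp
        ultimately have "(p x - p y) * (n x - n y) * k_kernel (x - y) - 2 * (p x * n y * j_kernel (x - y))
            \<le> - \<delta> * (p x * n y)" by (simp add: algebra_simps)
        then show ?case by (simp add: case_prod_beta x_y_def)
      qed
    qed
    also have "\<dots> = - \<delta> * (mass p * mass n)"
      using pn by (simp add: mass_def integrable_tensor(2) H_integrable)
    finally have "E_L p n \<le> c / 2 * (- \<delta> * (mass p * mass n))"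
      using c by (simp add: mult_left_mono)
    then show "E_L p n \<le> - (c / 2 * \<delta>) * (mass p * mass n)" by (simp add: algebra_simps)
  qed
qed

text \<open>Cauchy--Schwarz against the indicator function of the bounded domain.\<close>
lemma mass_square_le:
  assumes "u \<in> H"
  shows "(mass (\<lambda>x. \<bar>u x\<bar>))\<^sup>2 \<le> measure lborel \<Omega> * L2_inner u u"
proof -
  have "\<bar>u x\<bar> = \<bar>u x\<bar> * indicator \<Omega> x" for x
    using H_outside[OF assms, of x] by (auto simp: indicator_def)
  then have "(mass (\<lambda>x. \<bar>u x\<bar>))\<^sup>2 = (LINT x|lborel. \<bar>u x\<bar> * indicator \<Omega> x)\<^sup>2"
    unfolding mass_def by metis
  also have "\<dots> \<le> (LINT x|lborel. \<bar>u x\<bar>\<^sup>2) * (LINT x|lborel. (indicator \<Omega> x)\<^sup>2)"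
  proof (rule integral_Cauchy_Schwarz)
    have sq: "(indicator \<Omega> x :: real)\<^sup>2 = indicator \<Omega> x" for x by (simp add: indicator_def)
    show "integrable lborel (\<lambda>x. (indicator \<Omega> x :: real)\<^sup>2)" using integrable_domain by (simp add: sq)
    show "integrable lborel (\<lambda>x. \<bar>u x\<bar>\<^sup>2)" using H_integrable_square[OF assms] by simp
    have "(\<lambda>x. \<bar>u x\<bar> * indicator \<Omega> x) = (\<lambda>x. \<bar>u x\<bar>)"
      using H_outside[OF assms] by (auto simp: indicator_def fun_eq_iff)
    then show "integrable lborel (\<lambda>x. \<bar>u x\<bar> * indicator \<Omega> x)" using H_integrable[OF assms] by (simp only: integrable_abs)
  qed
  also have "\<dots> = measure lborel \<Omega> * L2_inner u u"
  proof -
    have sq: "(indicator \<Omega> x :: real)\<^sup>2 = indicator \<Omega> x" for x by (simp add: indicator_def)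
    show ?thesis using borel_domain by (simp add: sq L2_inner_self mult.commute)
  qed
  finally show ?thesis .
qed

text \<open>The far part is a bounded perturbation in \<open>L\<^sup>2\<close>: as \<open>j \<le> 1\<close>, it is at most
  \<open>(\<integral>|u|)\<^sup>2\<close>, hence at most the volume of \<open>\<Omega>\<close> times \<open>\<parallel>u\<parallel>\<^sup>2\<close>.\<close>
lemma E_L_close_to_E_form:
  obtains C where "0 \<le> C" "\<And>u. u \<in> H \<Longrightarrow> \<bar>E_L u u - E_form u u\<bar> \<le> C * L2_inner u u"
proof -
  define c where "c = c_const TYPE('a)"
  define \<rho> where "\<rho> = rho_const TYPE('a)"
  have c: "0 < c" by (simp add: c_def c_const_pos)
  show thesis
  proof (rule that)
    show "0 \<le> c * measure lborel \<Omega> + \<bar>\<rho>\<bar>" using c by simp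
    fix u assume u: "u \<in> H"
    have a: "integrable lborel (\<lambda>x. \<bar>u x\<bar>)" using H_integrable[OF u] by simp
    let ?J = "LINT (x, y)|(lborel \<Otimes>\<^sub>M lborel). u x * u y * j_kernel (x - y)"
    have "\<bar>?J\<bar> \<le> (LINT z|(lborel \<Otimes>\<^sub>M lborel). \<bar>(\<lambda>(x, y). u x * u y * j_kernel (x - y)) z\<bar>)"
      by (rule integral_abs_bound)
    also have "\<dots> \<le> (LINT (x, y)|(lborel \<Otimes>\<^sub>M lborel). \<bar>u x\<bar> * \<bar>u y\<bar>)"
      using j_kernel_le_1 H_integrable_far[OF u u] integrable_tensor[OF a a]
      by (intro integral_mono) (auto simp: abs_mult intro!: mult_left_le)
    also have "\<dots> = (mass (\<lambda>x. \<bar>u x\<bar>))\<^sup>2"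
      using integrable_tensor(2)[OF a a] by (simp add: mass_def power2_eq_square)
    also have "\<dots> \<le> measure lborel \<Omega> * L2_inner u u" by (rule mass_square_le[OF u])
    finally have J: "\<bar>?J\<bar> \<le> measure lborel \<Omega> * L2_inner u u" .
    have "E_L u u - E_form u u = \<rho> * L2_inner u u - c * ?J"
      by (simp add: E_L_def L2_inner_def c_def \<rho>_def)
    also have "\<bar>\<dots>\<bar> \<le> \<bar>\<rho>\<bar> * L2_inner u u + c * \<bar>?J\<bar>"
      using c L2_inner_self_nonneg[of u] abs_triangle_ineq4[of "\<rho> * L2_inner u u" "c * ?J"]
      by (simp add: abs_mult)
    also have "\<dots> \<le> (c * measure lborel \<Omega> + \<bar>\<rho>\<bar>) * L2_inner u u"
      using mult_left_mono[OF J, of c] c by (simp add: algebra_simps)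
    finally show "\<bar>E_L u u - E_form u u\<bar> \<le> (c * measure lborel \<Omega> + \<bar>\<rho>\<bar>) * L2_inner u u" .
  qed
qed

text \<open>For \<open>w \<ge> 0\<close> one has \<open>w(x)\<^sup>2 \<le> (w(x) - w(y))\<^sup>2 + 2 w(x) w(y)\<close>. Integrate this against the
  truncated kernel: the left side picks up the mass of the kernel, which is at least \<open>n \<omega>\<close>; the
  first term on the right is controlled by the energy, and in the second one the kernel is
  replaced by its maximum.\<close>
lemma L2_le_form_plus_mass:
  fixes n :: nat
  defines "\<omega> \<equiv> unit_ball_vol DIM('a) * (1 - (1/2) ^ DIM('a))"
  assumes w: "w \<in> H" and w0: "\<And>x. 0 \<le> w x"
  shows "real n * \<omega> * L2_inner w w \<le>
    2 / c_const TYPE('a) * E_form w w + 2 * 2 ^ (n * DIM('a)) * (mass w)\<^sup>2"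
proof -
  note [measurable] = H_measurable[OF w]
  let ?P = "lborel \<Otimes>\<^sub>M lborel :: ('a \<times> 'a) measure"
  have \<omega>: "0 \<le> \<omega>" unfolding \<omega>_def by (intro mult_nonneg_nonneg) (auto simp: power_le_one)
  let ?K = "2 ^ (n * DIM('a)) :: real"
  let ?rhs = "\<lambda>(x, y). (w x - w y)\<^sup>2 * k_kernel (x - y) + 2 * ?K * (w x * w y)"
  have int: "integrable ?P ?rhs"
    using Bochner_Integration.integrable_add[OF H_integrable_form_diag[OF w]
      integrable_mult_right[OF integrable_tensor(1)[OF H_integrable[OF w] H_integrable[OF w]], of "2 * ?K"]]
    by (simp add: case_prod_beta')
  have rhs: "(LINT z|?P. ?rhs z) = 2 / c_const TYPE('a) * E_form w w + 2 * ?K * (mass w)\<^sup>2"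
    using Bochner_Integration.integral_add[OF H_integrable_form_diag[OF w]
      integrable_mult_right[OF integrable_tensor(1)[OF H_integrable[OF w] H_integrable[OF w]], of "2 * ?K"]]
      integrable_tensor(2)[OF H_integrable[OF w] H_integrable[OF w]] c_const_pos[where 'a='a]
    by (simp add: case_prod_beta' E_form_def power2_eq_square mass_def)
  have "ennreal (real n * \<omega> * L2_inner w w) = ennreal (real n * \<omega>) * ennreal (L2_inner w w)"
    using \<omega> by (simp add: ennreal_mult L2_inner_self_nonneg)
  also have "ennreal (L2_inner w w) = (\<integral>\<^sup>+x. ennreal ((w x)\<^sup>2) \<partial>lborel)"
    unfolding L2_inner_self by (rule nn_integral_eq_integral[symmetric]) (auto intro: H_integrable_square w)
  also have "ennreal (real n * \<omega>) * (\<integral>\<^sup>+x. ennreal ((w x)\<^sup>2) \<partial>lborel) =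
      (\<integral>\<^sup>+x. ennreal (real n * \<omega>) * ennreal ((w x)\<^sup>2) \<partial>lborel)"
    by (rule nn_integral_cmult[symmetric]) auto
  also have "\<dots> \<le> (\<integral>\<^sup>+x. (\<integral>\<^sup>+y. ennreal (truncated_kernel n (x - y)) \<partial>lborel) * ennreal ((w x)\<^sup>2) \<partial>lborel)"
    unfolding \<omega>_def by (intro nn_integral_mono mult_right_mono nn_integral_truncated_kernel_ge) auto
  also have "\<dots> = (\<integral>\<^sup>+x. \<integral>\<^sup>+y. ennreal (truncated_kernel n (x - y)) * ennreal ((w x)\<^sup>2) \<partial>lborel \<partial>lborel)"
    by (intro nn_integral_cong nn_integral_multc[symmetric]) auto
  also have "\<dots> \<le> (\<integral>\<^sup>+x. \<integral>\<^sup>+y. ennreal (?rhs (x, y)) \<partial>lborel \<partial>lborel)"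
  proof (intro nn_integral_mono)
    fix x y
    have "truncated_kernel n (x - y) * (w x)\<^sup>2 \<le>
        truncated_kernel n (x - y) * ((w x - w y)\<^sup>2 + 2 * (w x * w y))"
      using w0[of x] w0[of y] truncated_kernel_nonneg
      by (intro mult_left_mono) (auto simp: power2_diff)
    also have "\<dots> = truncated_kernel n (x - y) * (w x - w y)\<^sup>2 + truncated_kernel n (x - y) * (2 * (w x * w y))"
      by (simp add: distrib_left)
    also have "\<dots> \<le> k_kernel (x - y) * (w x - w y)\<^sup>2 + ?K * (2 * (w x * w y))"
      using w0 by (intro add_mono mult_right_mono truncated_kernel_le truncated_kernel_le_k) auto
    finally show "ennreal (truncated_kernel n (x - y)) * ennreal ((w x)\<^sup>2) \<le> ennreal (?rhs (x, y))"
      by (subst ennreal_mult[symmetric]) (auto intro!: ennreal_leI simp: algebra_simps truncated_kernel_nonneg)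
  qed
  also have "\<dots> = (\<integral>\<^sup>+z. ennreal (?rhs z) \<partial>?P)"
    by (rule lborel.nn_integral_fst) measurable
  also have "\<dots> = ennreal (LINT z|?P. ?rhs z)"
    using w0 by (intro nn_integral_eq_integral int AE_I2) auto
  also have "\<dots> = ennreal (2 / c_const TYPE('a) * E_form w w + 2 * ?K * (mass w)\<^sup>2)"
    by (simp only: rhs)
  finally show ?thesis
    using E_form_self_nonneg[of w] c_const_pos[where 'a='a] by (subst (asm) ennreal_le_iff) auto
qed

text \<open>The factor \<open>n \<omega>\<close> on the left of the preceding inequality is unbounded, so for large \<open>n\<close> the
  energy term, at most a multiple of \<open>\<parallel>w\<parallel>\<^sup>2\<close> by assumption, can be absorbed.\<close>
lemma reverse_Hoelder:
  obtains e where "e > 0"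
    "\<And>w. w \<in> H \<Longrightarrow> (\<And>x. 0 \<le> w x) \<Longrightarrow> E_L w w \<le> B * L2_inner w w \<Longrightarrow> e * L2_inner w w \<le> (mass w)\<^sup>2"
proof -
  define \<omega> where "\<omega> = unit_ball_vol DIM('a) * (1 - (1/2) ^ DIM('a))"
  have "(1/2 :: real) ^ DIM('a) < 1" by (subst power_less_one_iff) auto
  then have \<omega>: "0 < \<omega>" by (simp add: \<omega>_def)
  obtain C where C: "0 \<le> C" "\<And>u. u \<in> H \<Longrightarrow> \<bar>E_L u u - E_form u u\<bar> \<le> C * L2_inner u u"
    using E_L_close_to_E_form by blast
  define c where "c = c_const TYPE('a)"
  have c: "0 < c" by (simp add: c_def c_const_pos)
  obtain n :: nat where "(2 / c * (B + C) + 1) / \<omega> \<le> real n" using real_arch_simple by blast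
  then have n: "2 / c * (B + C) + 1 \<le> real n * \<omega>" using \<omega> by (simp add: divide_le_eq)
  define K :: real where "K = 2 * 2 ^ (n * DIM('a))"
  have K: "0 < K" by (simp add: K_def)
  show thesis
  proof (rule that[of "1 / K"])
    show "0 < 1 / K" using K by simp
    fix w assume w: "w \<in> H" "\<And>x. 0 \<le> w x" "E_L w w \<le> B * L2_inner w w"
    have "E_form w w \<le> (B + C) * L2_inner w w"
      using C(2)[OF w(1)] w(3) by (simp add: distrib_right abs_le_iff)
    then have "2 / c * E_form w w \<le> 2 / c * ((B + C) * L2_inner w w)"
      using c by (intro mult_left_mono) auto
    moreover have "(2 / c * (B + C) + 1) * L2_inner w w \<le> real n * \<omega> * L2_inner w w"
      using n L2_inner_self_nonneg by (rule mult_right_mono)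
    moreover have "real n * \<omega> * L2_inner w w \<le> 2 / c * E_form w w + K * (mass w)\<^sup>2"
      using L2_le_form_plus_mass[OF w(1,2), of n] by (simp add: \<omega>_def c_def K_def)
    moreover have "(2 / c * (B + C) + 1) * L2_inner w w = 2 / c * ((B + C) * L2_inner w w) + L2_inner w w"
      by (simp add: distrib_right mult.assoc)
    ultimately have "L2_inner w w \<le> K * (mass w)\<^sup>2" by linarith
    then show "1 / K * L2_inner w w \<le> (mass w)\<^sup>2" using K by (simp add: divide_le_eq mult.commute)
  qed
qed

end

section \<open>Completeness of the energy space\<close>

lemma nn_integral_AE_limit_le:
  fixes f :: "nat \<Rightarrow> 'b \<Rightarrow> real"
  assumes [measurable]: "\<And>i. f i \<in> borel_measurable M" and lim: "AE x in M. (\<lambda>i. f i x) \<longlonglongrightarrow> g x"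
    and le: "\<And>i. (\<integral>\<^sup>+x. ennreal (f i x) \<partial>M) \<le> e"
  shows "(\<integral>\<^sup>+x. ennreal (g x) \<partial>M) \<le> e"
proof -
  have "(\<integral>\<^sup>+x. ennreal (g x) \<partial>M) = (\<integral>\<^sup>+x. liminf (\<lambda>i. ennreal (f i x)) \<partial>M)"
    using lim
  proof (intro nn_integral_cong_AE, eventually_elim)
    case (elim x)
    then show ?case
      by (intro lim_imp_Liminf[symmetric] tendsto_ennrealI) auto
  qed
  also have "\<dots> \<le> liminf (\<lambda>i. \<integral>\<^sup>+x. ennreal (f i x) \<partial>M)"
    by (intro nn_integral_liminf) auto
  also have "\<dots> \<le> liminf (\<lambda>i::nat. e)" by (intro Liminf_mono always_eventually allI le)
  also have "\<dots> = e" by (simp add: Liminf_const)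
  finally show ?thesis .
qed

context log_laplacian_domain
begin

definition energy_norm2 :: "('a \<Rightarrow> real) \<Rightarrow> real" where
  "energy_norm2 u = E_form u u + L2_inner u u"

lemma nn_integral_square:
  assumes "u \<in> H"
  shows "(\<integral>\<^sup>+x. ennreal ((u x)\<^sup>2) \<partial>lborel) = ennreal (L2_inner u u)"
  unfolding L2_inner_self by (rule nn_integral_eq_integral) (auto intro: H_integrable_square assms)

lemma nn_integral_form:
  assumes "u \<in> H"
  shows "(\<integral>\<^sup>+z. ennreal ((u (fst z) - u (snd z))\<^sup>2 * k_kernel (fst z - snd z)) \<partial>(lborel \<Otimes>\<^sub>M lborel)) =
    ennreal (2 / c_const TYPE('a) * E_form u u)"
proof -
  have "(\<integral>\<^sup>+z. ennreal ((u (fst z) - u (snd z))\<^sup>2 * k_kernel (fst z - snd z)) \<partial>(lborel \<Otimes>\<^sub>M lborel)) =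
    ennreal (LINT z|(lborel \<Otimes>\<^sub>M lborel). (u (fst z) - u (snd z))\<^sup>2 * k_kernel (fst z - snd z))"
    by (rule nn_integral_eq_integral)
      (use H_integrable_form_diag[OF assms] in \<open>auto simp: case_prod_beta'\<close>)
  then show ?thesis using c_const_pos[where 'a='a]
    by (simp add: E_form_def case_prod_beta' power2_eq_square)
qed

text \<open>The Riesz--Fischer argument: on a bounded domain an energy Cauchy sequence is Cauchy in
  \<open>L\<^sup>1\<close>, so a subsequence converges almost everywhere, and Fatou's lemma, applied to the
  differences \<open>u n - u (r i)\<close> with \<open>i \<rightarrow> \<infinity>\<close>, carries the Cauchy estimate over to the limit.\<close>
lemma H_complete:
  assumes u: "\<And>n. u n \<in> H"
    and cauchy: "\<And>e. 0 < e \<Longrightarrow> \<exists>N. \<forall>i\<ge>N. \<forall>j\<ge>N. energy_norm2 (\<lambda>x. u i x - u j x) < e"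
  obtains v where "v \<in> H" "(\<lambda>n. energy_norm2 (\<lambda>x. u n x - v x)) \<longlonglongrightarrow> 0"
proof -
  define c where "c = c_const TYPE('a)"
  have c: "0 < c" by (simp add: c_def c_const_pos)
  note [measurable] = H_measurable[OF u]
  have L1: "\<exists>N. \<forall>i\<ge>N. \<forall>j\<ge>N. (LINT x|lborel. norm (u i x - u j x)) < e" if "0 < e" for e
  proof -
    define m where "m = measure lborel \<Omega> + 1"
    have m: "0 < m" "measure lborel \<Omega> \<le> m" by (auto simp: m_def add_nonneg_pos)
    obtain N where N: "\<And>i j. i \<ge> N \<Longrightarrow> j \<ge> N \<Longrightarrow> energy_norm2 (\<lambda>x. u i x - u j x) < e\<^sup>2 / m"
      using cauchy[of "e\<^sup>2 / m"] \<open>0 < e\<close> m by auto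
    have "(LINT x|lborel. norm (u i x - u j x)) < e" if "i \<ge> N" "j \<ge> N" for i j
    proof -
      let ?w = "\<lambda>x. u i x - u j x"
      have "(mass (\<lambda>x. \<bar>?w x\<bar>))\<^sup>2 \<le> measure lborel \<Omega> * L2_inner ?w ?w"
        by (intro mass_square_le H_diff u)
      also have "\<dots> \<le> m * energy_norm2 ?w"
        using m E_form_self_nonneg[of ?w] L2_inner_self_nonneg[of ?w]
        by (intro mult_mono) (auto simp: energy_norm2_def)
      also have "\<dots> < e\<^sup>2" using N[OF that] m by (simp add: pos_less_divide_eq mult.commute)
      finally have "mass (\<lambda>x. \<bar>?w x\<bar>) < e" using \<open>0 < e\<close> by (simp add: power_less_imp_less_base)
      then show ?thesis by (simp add: mass_def)
    qed
    then show ?thesis by blast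
  qed
  obtain r where r: "strict_mono r" and ae: "AE x in lborel. Cauchy (\<lambda>i. u (r i) x)"
    using cauchy_L1_AE_cauchy_subseq[of lborel u] H_integrable[OF u] L1 by metis
  define v where "v x = lim (\<lambda>i. u (r i) x)" for x
  have [measurable]: "v \<in> borel_measurable borel"
    unfolding v_def by (rule borel_measurable_lim_metric) simp
  have v_out: "v x = 0" if "x \<notin> \<Omega>" for x
    using H_outside[OF u that] by (simp add: v_def)
  have ae1: "AE x in lborel. (\<lambda>i. u (r i) x) \<longlonglongrightarrow> v x"
    using ae by eventually_elim (simp add: v_def Cauchy_convergent_iff convergent_LIMSEQ_iff)
  have close: "(\<lambda>x. u n x - v x) \<in> H \<and> energy_norm2 (\<lambda>x. u n x - v x) \<le> 2 * e"
    if "0 < e" and N: "\<And>i. i \<ge> N \<Longrightarrow> energy_norm2 (\<lambda>x. u n x - u i x) < e" for n N e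
  proof -
    let ?w = "\<lambda>i x. u n x - u (r (i + N)) x" and ?w' = "\<lambda>x. u n x - v x"
    have w: "?w i \<in> H" for i by (intro H_diff u)
    have "i + N \<le> r (i + N)" for i using r by (rule strict_mono_imp_increasing)
    then have "N \<le> r (i + N)" for i using le_trans[OF le_add2] by blast
    then have we: "energy_norm2 (?w i) < e" for i by (intro N)
    have e1: "L2_inner (?w i) (?w i) \<le> e" and e2: "E_form (?w i) (?w i) \<le> e" for i
      using we[of i] E_form_self_nonneg[of "?w i"] L2_inner_self_nonneg[of "?w i"]
      by (auto simp: energy_norm2_def)
    have shift: "(\<lambda>i. u (r (i + N)) x) \<longlonglongrightarrow> v x" if "(\<lambda>i. u (r i) x) \<longlonglongrightarrow> v x" for x
      using that by (rule LIMSEQ_ignore_initial_segment)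
    have 1: "(\<integral>\<^sup>+x. ennreal ((?w' x)\<^sup>2) \<partial>lborel) \<le> ennreal e"
    proof (rule nn_integral_AE_limit_le)
      show "AE x in lborel. (\<lambda>i. (?w i x)\<^sup>2) \<longlonglongrightarrow> (?w' x)\<^sup>2"
        using ae1 by eventually_elim (intro tendsto_intros shift)
      show "(\<integral>\<^sup>+x. ennreal ((?w i x)\<^sup>2) \<partial>lborel) \<le> ennreal e" for i
        using e1[of i] by (simp add: nn_integral_square[OF w] ennreal_leI)
    qed simp
    have 2: "(\<integral>\<^sup>+z. ennreal ((?w' (fst z) - ?w' (snd z))\<^sup>2 * k_kernel (fst z - snd z)) \<partial>(lborel \<Otimes>\<^sub>M lborel))
        \<le> ennreal (2 / c * e)"
    proof (rule nn_integral_AE_limit_le)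
      show "AE z in lborel \<Otimes>\<^sub>M lborel.
          (\<lambda>i. (?w i (fst z) - ?w i (snd z))\<^sup>2 * k_kernel (fst z - snd z)) \<longlonglongrightarrow>
          (?w' (fst z) - ?w' (snd z))\<^sup>2 * k_kernel (fst z - snd z)"
        using AE_lborel_fst_snd[OF ae1] by eventually_elim (intro tendsto_intros shift; simp)
      show "(\<integral>\<^sup>+z. ennreal ((?w i (fst z) - ?w i (snd z))\<^sup>2 * k_kernel (fst z - snd z)) \<partial>(lborel \<Otimes>\<^sub>M lborel))
          \<le> ennreal (2 / c * e)" for i
        unfolding nn_integral_form[OF w] c_def[symmetric]
        using c e2[of i] by (intro ennreal_leI mult_left_mono) auto
    qed measurable
    have I1: "integrable lborel (\<lambda>x. (?w' x)\<^sup>2)"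
    proof (rule integrableI_bounded)
      show "(\<integral>\<^sup>+x. ennreal (norm ((?w' x)\<^sup>2)) \<partial>lborel) < \<infinity>"
        using 1 by (simp add: order.strict_trans1[OF 1])
    qed simp
    have I2: "integrable (lborel \<Otimes>\<^sub>M lborel)
        (\<lambda>z. (?w' (fst z) - ?w' (snd z))\<^sup>2 * k_kernel (fst z - snd z))"
    proof (rule integrableI_bounded)
      show "(\<integral>\<^sup>+z. ennreal (norm ((?w' (fst z) - ?w' (snd z))\<^sup>2 * k_kernel (fst z - snd z))) \<partial>(lborel \<Otimes>\<^sub>M lborel)) < \<infinity>"
        using order.strict_trans1[OF 2] by (simp add: abs_mult)
    qed measurable
    have w': "?w' \<in> H"
      using I1 I2 borel_domain v_out H_outside[OF u] by (auto simp: H_space_iff case_prod_beta')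
    have "ennreal (L2_inner ?w' ?w') \<le> ennreal e" using 1 unfolding nn_integral_square[OF w'] .
    then have l: "L2_inner ?w' ?w' \<le> e" using \<open>0 < e\<close> by (subst (asm) ennreal_le_iff) auto
    have "ennreal (2 / c * E_form ?w' ?w') \<le> ennreal (2 / c * e)"
      using 2 unfolding nn_integral_form[OF w'] c_def .
    then have "2 / c * E_form ?w' ?w' \<le> 2 / c * e" using \<open>0 < e\<close> c by (subst (asm) ennreal_le_iff) auto
    then have "E_form ?w' ?w' \<le> e" using c by (simp add: divide_le_cancel)
    with l w' show ?thesis by (simp add: energy_norm2_def)
  qed
  show thesis
  proof (rule that)
    obtain N where "\<And>i j. i \<ge> N \<Longrightarrow> j \<ge> N \<Longrightarrow> energy_norm2 (\<lambda>x. u i x - u j x) < 1"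
      using cauchy[of 1] by auto
    then have "(\<lambda>x. u N x - v x) \<in> H" using close[of 1 N N] by simp
    then show "v \<in> H" using H_diff[OF u[of N]] by fastforce
    show "(\<lambda>n. energy_norm2 (\<lambda>x. u n x - v x)) \<longlonglongrightarrow> 0"
    proof (rule LIMSEQ_I)
      fix e :: real assume "0 < e"
      then obtain N where N: "\<And>i j. i \<ge> N \<Longrightarrow> j \<ge> N \<Longrightarrow> energy_norm2 (\<lambda>x. u i x - u j x) < e / 4"
        using cauchy[of "e / 4"] by auto
      have "norm (energy_norm2 (\<lambda>x. u n x - v x) - 0) < e" if "n \<ge> N" for n
      proof -
        have "energy_norm2 (\<lambda>x. u n x - v x) \<le> 2 * (e / 4)"
          using close[of "e / 4" N n] N that \<open>0 < e\<close> by simp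
        moreover have "0 \<le> energy_norm2 (\<lambda>x. u n x - v x)"
          using E_form_self_nonneg L2_inner_self_nonneg by (simp add: energy_norm2_def)
        ultimately show ?thesis using \<open>0 < e\<close> by simp
      qed
      then show "\<exists>N. \<forall>n\<ge>N. norm (energy_norm2 (\<lambda>x. u n x - v x) - 0) < e" by blast
    qed
  qed
qed

section \<open>Positive and negative parts\<close>

text \<open>The trivial coefficients are kept so that the right-hand sides are literal instances of
  the linear combinations in the expansion lemmas for the two forms.\<close>
lemma pos_neg_lincomb: "u = (\<lambda>x. 1 * pos_part u x + (- 1) * neg_part u x)"
  by (auto simp: pos_part_def neg_part_def fun_eq_iff max_def)

lemma abs_lincomb: "(\<lambda>x. \<bar>u x :: real\<bar>) = (\<lambda>x. 1 * pos_part u x + 1 * neg_part u x)"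
  by (auto simp: pos_part_def neg_part_def fun_eq_iff max_def)

lemma pos_part_nonneg [simp]: "0 \<le> pos_part u x" and neg_part_nonneg [simp]: "0 \<le> neg_part u x"
  and pos_times_neg [simp]: "pos_part u x * neg_part u x = 0"
  by (auto simp: pos_part_def neg_part_def max_def)

lemma L2_inner_pos_neg [simp]: "L2_inner (pos_part u) (neg_part u) = 0"
  by (simp add: L2_inner_def)

lemma E_L_split:
  assumes "u \<in> H"
  shows "E_L u u = E_L (pos_part u) (pos_part u) + E_L (neg_part u) (neg_part u)
    - 2 * E_L (pos_part u) (neg_part u)"
  using E_L_quadratic[OF H_pos_part[OF assms] H_neg_part[OF assms], of 1 "- 1",
      unfolded pos_neg_lincomb[symmetric]] by simp

lemma E_L_abs:
  assumes "u \<in> H"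
  shows "E_L (\<lambda>x. \<bar>u x\<bar>) (\<lambda>x. \<bar>u x\<bar>) = E_L (pos_part u) (pos_part u) + E_L (neg_part u) (neg_part u)
    + 2 * E_L (pos_part u) (neg_part u)"
  using E_L_quadratic[OF H_pos_part[OF assms] H_neg_part[OF assms], of 1 1,
      unfolded abs_lincomb[symmetric]] by simp

lemma L2_inner_split:
  assumes "u \<in> H"
  shows "L2_inner u u = L2_inner (pos_part u) (pos_part u) + L2_inner (neg_part u) (neg_part u)"
  using L2_inner_quadratic[OF H_pos_part[OF assms] H_neg_part[OF assms], of 1 "- 1",
      unfolded pos_neg_lincomb[symmetric]] by simp

lemma L2_inner_abs: "L2_inner (\<lambda>x. \<bar>u x\<bar>) (\<lambda>x. \<bar>u x\<bar>) = L2_inner u u"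
  by (simp add: L2_inner_def)

lemma E_L_pos_neg_nonpos:
  assumes "u \<in> H"
  shows "E_L (pos_part u) (neg_part u) \<le> 0"
proof -
  obtain d where d: "d > 0"
    "\<And>p n. p \<in> H \<Longrightarrow> n \<in> H \<Longrightarrow> AE x in lborel. 0 \<le> p x \<Longrightarrow> AE x in lborel. 0 \<le> n x \<Longrightarrow>
       AE x in lborel. p x * n x = 0 \<Longrightarrow> E_L p n \<le> - d * (mass p * mass n)"
    using separated_interaction by blast
  have "E_L (pos_part u) (neg_part u) \<le> - d * (mass (pos_part u) * mass (neg_part u))"
    using assms by (intro d) (auto intro: H_pos_part H_neg_part)
  also have "\<dots> \<le> 0" using d(1) by (simp add: mass_nonneg)
  finally show ?thesis .
qed

lemma E_L_abs_le:
  assumes "u \<in> H"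
  shows "E_L (\<lambda>x. \<bar>u x\<bar>) (\<lambda>x. \<bar>u x\<bar>) \<le> E_L u u"
  using E_L_abs[OF assms] E_L_split[OF assms] E_L_pos_neg_nonpos[OF assms] by simp

text \<open>Two nonnegative functions of the same norm cannot differ mainly in one direction. Since
  \<open>\<integral>(u - v) (u + v) = 0\<close>, the weights of the two parts of \<open>w = u - v\<close> against \<open>u + v\<close> agree.
  The positive part satisfies \<open>w\<^sup>+ \<le> u + v\<close>, so its weight is at least \<open>\<parallel>w\<^sup>+\<parallel>\<^sup>2\<close>, whereas the weight
  of the negative part is bounded by Young's inequality with parameter \<open>t\<close>.\<close>
lemma pos_part_diff_bound:
  assumes uv: "u \<in> H" "v \<in> H" and nonneg: "\<And>x. 0 \<le> u x" "\<And>x. 0 \<le> v x"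
    and unit: "L2_inner u u = 1" "L2_inner v v = 1" and "0 < t"
  shows "L2_inner (pos_part (\<lambda>x. u x - v x)) (pos_part (\<lambda>x. u x - v x)) \<le>
    t / 2 * L2_inner (neg_part (\<lambda>x. u x - v x)) (neg_part (\<lambda>x. u x - v x)) + 2 / t"
proof -
  let ?w = "\<lambda>x. u x - v x"
  have w: "?w \<in> H" using uv by (rule H_diff)
  have uv2: "L2_inner u v \<le> 1"
    using L2_inner_self_nonneg[of "\<lambda>x. 1 * u x + (- 1) * v x"]
    unfolding L2_inner_quadratic[OF uv] by (simp add: unit)
  have pointwise: "(pos_part ?w x)\<^sup>2 \<le> ((u x)\<^sup>2 - (v x)\<^sup>2) + t / 2 * (neg_part ?w x)\<^sup>2 +
      1 / (2 * t) * (1 * u x + 1 * v x)\<^sup>2" for x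
  proof -
    define s where "s = u x + v x"
    have "0 \<le> (t * neg_part ?w x - s)\<^sup>2 / (2 * t)" using \<open>0 < t\<close> by simp
    also have "\<dots> = t / 2 * (neg_part ?w x)\<^sup>2 + 1 / (2 * t) * s\<^sup>2 - neg_part ?w x * s"
      using \<open>0 < t\<close> by (simp add: power2_eq_square field_simps)
    finally have 1: "neg_part ?w x * s \<le> t / 2 * (neg_part ?w x)\<^sup>2 + 1 / (2 * t) * s\<^sup>2" by simp
    have "pos_part ?w x \<le> s" using nonneg[of x] by (simp add: pos_part_def s_def)
    then have "(pos_part ?w x)\<^sup>2 \<le> pos_part ?w x * s"
      unfolding power2_eq_square by (intro mult_left_mono) auto
    also have "\<dots> = ((u x)\<^sup>2 - (v x)\<^sup>2) + neg_part ?w x * s"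
      by (auto simp: pos_part_def neg_part_def s_def max_def power2_eq_square algebra_simps)
    finally show ?thesis using 1 by (simp add: s_def)
  qed
  have I: "integrable lborel (\<lambda>x. (u x)\<^sup>2)" "integrable lborel (\<lambda>x. (v x)\<^sup>2)"
    "integrable lborel (\<lambda>x. (neg_part ?w x)\<^sup>2)" "integrable lborel (\<lambda>x. (1 * u x + 1 * v x)\<^sup>2)"
    "integrable lborel (\<lambda>x. (pos_part ?w x)\<^sup>2)"
    using uv w H_lincomb[OF uv, of 1 1] by (auto intro!: H_integrable_square H_neg_part H_pos_part H_add)
  have "L2_inner (pos_part ?w) (pos_part ?w) \<le> (LINT x|lborel. ((u x)\<^sup>2 - (v x)\<^sup>2) +
      t / 2 * (neg_part ?w x)\<^sup>2 + 1 / (2 * t) * (1 * u x + 1 * v x)\<^sup>2)"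
    unfolding L2_inner_self using pointwise I
    by (intro integral_mono Bochner_Integration.integrable_add Bochner_Integration.integrable_diff
        integrable_mult_right) auto
  also have "\<dots> = (L2_inner u u - L2_inner v v) + t / 2 * L2_inner (neg_part ?w) (neg_part ?w) +
      1 / (2 * t) * L2_inner (\<lambda>x. 1 * u x + 1 * v x) (\<lambda>x. 1 * u x + 1 * v x)"
    unfolding L2_inner_self using I by simp
  also have "\<dots> \<le> t / 2 * L2_inner (neg_part ?w) (neg_part ?w) + 2 / t"
    unfolding L2_inner_quadratic[OF uv] using uv2 \<open>0 < t\<close> unit by (simp add: field_simps)
  finally show ?thesis .
qed

section \<open>Existence of a ground state\<close>

lemma E_L_diff:
  assumes "u \<in> H" "v \<in> H"
  shows "E_L (\<lambda>x. u x - v x) (\<lambda>x. u x - v x) = E_L u u - 2 * E_L u v + E_L v v"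
  using E_L_quadratic[OF assms, of 1 "- 1"] by simp

lemma L2_inner_diff:
  assumes "u \<in> H" "v \<in> H"
  shows "L2_inner (\<lambda>x. u x - v x) (\<lambda>x. u x - v x) = L2_inner u u - 2 * L2_inner u v + L2_inner v v"
  using L2_inner_quadratic[OF assms, of 1 "- 1"] by simp

lemma E_L_add:
  assumes "u \<in> H" "v \<in> H"
  shows "E_L (\<lambda>x. u x + v x) (\<lambda>x. u x + v x) = E_L u u + 2 * E_L u v + E_L v v"
  using E_L_quadratic[OF assms, of 1 1] by simp

lemma L2_inner_add:
  assumes "u \<in> H" "v \<in> H"
  shows "L2_inner (\<lambda>x. u x + v x) (\<lambda>x. u x + v x) = L2_inner u u + 2 * L2_inner u v + L2_inner v v"
  using L2_inner_quadratic[OF assms, of 1 1] by simp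

lemma E_L_scale: "u \<in> H \<Longrightarrow> E_L (\<lambda>x. s * u x) (\<lambda>x. s * u x) = s\<^sup>2 * E_L u u"
  using E_L_quadratic[of u u s 0] by simp

lemma L2_inner_scale: "u \<in> H \<Longrightarrow> L2_inner (\<lambda>x. s * u x) (\<lambda>x. s * u x) = s\<^sup>2 * L2_inner u u"
  using L2_inner_quadratic[of u u s 0] by simp

definition spectral_bound :: "real \<Rightarrow> bool" where
  "spectral_bound \<mu> \<longleftrightarrow> (\<forall>v\<in>H. \<mu> * L2_inner v v \<le> E_L v v)"

text \<open>The parallelogram identity, with the spectral bound applied to the sum \<open>u + v\<close>.\<close>
lemma near_minimizers_excess:
  assumes \<mu>: "spectral_bound \<mu>" and uv: "u \<in> H" "v \<in> H"
    and unit: "L2_inner u u = 1" "L2_inner v v = 1"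
    and near: "E_L u u \<le> \<mu> + \<delta>" "E_L v v \<le> \<mu> + \<delta>"
  shows "E_L (\<lambda>x. u x - v x) (\<lambda>x. u x - v x) \<le>
    \<mu> * L2_inner (\<lambda>x. u x - v x) (\<lambda>x. u x - v x) + 4 * \<delta>"
proof -
  have "\<mu> * L2_inner (\<lambda>x. u x + v x) (\<lambda>x. u x + v x) \<le> E_L (\<lambda>x. u x + v x) (\<lambda>x. u x + v x)"
    using \<mu> H_add[OF uv] by (simp add: spectral_bound_def)
  then show ?thesis
    using near by (simp add: E_L_add E_L_diff L2_inner_add L2_inner_diff uv unit algebra_simps)
qed

text \<open>Suppose \<open>w = u - v\<close> satisfies \<open>\<parallel>w\<parallel>\<^sup>2 \<ge> s\<close>. Then both parts of \<open>w\<close> have norm bounded below in terms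
  of \<open>s\<close>. Splitting the energy of \<open>w\<close> and using the spectral bound for each part shows that
  both parts are almost minimizers up to \<open>4 \<delta>\<close>, so that the reverse Hoelder inequality applies to
  them, and that the interaction \<open>d (\<integral>w\<^sup>+) (\<integral>w\<^sup>-)\<close> is at most \<open>2 \<delta>\<close>. For small \<open>\<delta>\<close> these contradict
  each other.\<close>
lemma near_minimizers_close:
  assumes \<mu>: "spectral_bound \<mu>" and "0 < s"
  obtains \<delta> where "0 < \<delta>"
    "\<And>u v. u \<in> H \<Longrightarrow> v \<in> H \<Longrightarrow> (\<And>x. 0 \<le> u x) \<Longrightarrow> (\<And>x. 0 \<le> v x) \<Longrightarrow>
       L2_inner u u = 1 \<Longrightarrow> L2_inner v v = 1 \<Longrightarrow> E_L u u \<le> \<mu> + \<delta> \<Longrightarrow> E_L v v \<le> \<mu> + \<delta> \<Longrightarrow>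
       L2_inner (\<lambda>x. u x - v x) (\<lambda>x. u x - v x) < s"
proof -
  obtain d where d: "d > 0"
    "\<And>p n. p \<in> H \<Longrightarrow> n \<in> H \<Longrightarrow> AE x in lborel. 0 \<le> p x \<Longrightarrow> AE x in lborel. 0 \<le> n x \<Longrightarrow>
       AE x in lborel. p x * n x = 0 \<Longrightarrow> E_L p n \<le> - d * (mass p * mass n)"
    using separated_interaction by blast
  obtain e where e: "e > 0"
    "\<And>w. w \<in> H \<Longrightarrow> (\<And>x. 0 \<le> w x) \<Longrightarrow> E_L w w \<le> (\<mu> + 4) * L2_inner w w \<Longrightarrow> e * L2_inner w w \<le> (mass w)\<^sup>2"
    using reverse_Hoelder[of "\<mu> + 4"] by blast
  \<comment> \<open>the common lower bound for the squared norms of the two parts of the difference\<close>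
  define s' where "s' = min (s / 2) (s\<^sup>2 / 16)"
  have s': "0 < s'" "s' \<le> s / 2" "s' \<le> s\<^sup>2 / 16" using \<open>0 < s\<close> by (auto simp: s'_def)
  define \<delta> where "\<delta> = min s' (d * e * s' / 4)"
  have \<delta>: "0 < \<delta>" "\<delta> \<le> s'" "\<delta> \<le> d * e * s' / 4" using s' d(1) e(1) by (auto simp: \<delta>_def)
  show thesis
  proof (rule that[OF \<delta>(1)], rule ccontr)
    fix u v
    assume uv: "u \<in> H" "v \<in> H" and nonneg: "\<And>x. 0 \<le> u x" "\<And>x. 0 \<le> v x"
      and unit: "L2_inner u u = 1" "L2_inner v v = 1"
      and near: "E_L u u \<le> \<mu> + \<delta>" "E_L v v \<le> \<mu> + \<delta>"
      and far: "\<not> L2_inner (\<lambda>x. u x - v x) (\<lambda>x. u x - v x) < s"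
    define w where "w = (\<lambda>x. u x - v x)"
    have w: "w \<in> H" unfolding w_def using uv by (rule H_diff)
    define p n where "p = pos_part w" and "n = neg_part w"
    have pn: "p \<in> H" "n \<in> H" using w by (auto simp: p_def n_def H_pos_part H_neg_part)
    define P Q where "P = L2_inner p p" and "Q = L2_inner n n"
    have "neg_part (\<lambda>x. v x - u x) = p" "pos_part (\<lambda>x. v x - u x) = n"
      by (auto simp: p_def n_def w_def pos_part_def neg_part_def)
    then have PQ: "P \<le> t / 2 * Q + 2 / t" "Q \<le> t / 2 * P + 2 / t" if "0 < t" for t
      using pos_part_diff_bound[OF uv nonneg unit that]
        pos_part_diff_bound[OF uv(2,1) nonneg(2,1) unit(2,1) that]
      by (simp_all add: P_def Q_def p_def n_def w_def)
    have sum: "s \<le> P + Q" using far L2_inner_split[OF w] by (simp add: P_def Q_def p_def n_def w_def)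
    \<comment> \<open>with \<open>t = 8 / s\<close>, a part below \<open>s'\<close> forces the other one below \<open>s / 2\<close>, against \<open>P + Q \<ge> s\<close>\<close>
    have t: "P \<le> 4 * Q / s + s / 4" "Q \<le> 4 * P / s + s / 4" using PQ[of "8 / s"] \<open>0 < s\<close> by simp_all
    have both: "s' \<le> P'" if "s \<le> P' + Q'" "Q' \<le> 4 * P' / s + s / 4" for P' Q'
    proof (rule ccontr)
      assume "\<not> s' \<le> P'"
      then have "P' < s / 2" "P' < s\<^sup>2 / 16" using s' by auto
      then have "4 * P' / s < s / 4" using \<open>0 < s\<close> by (simp add: divide_less_eq power2_eq_square)
      then show False using that \<open>P' < s / 2\<close> by linarith
    qed
    have P: "s' \<le> P" using both[of P Q] sum t by simp
    have Q: "s' \<le> Q" using both[of Q P] sum t by simp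
    have excess: "E_L w w \<le> \<mu> * (P + Q) + 4 * \<delta>"
      using near_minimizers_excess[OF \<mu> uv unit near] L2_inner_split[OF w]
      by (simp add: P_def Q_def p_def n_def w_def)
    have E: "E_L w w = E_L p p + E_L n n - 2 * E_L p n"
      using E_L_split[OF w] by (simp add: p_def n_def)
    have lower: "\<mu> * P \<le> E_L p p" "\<mu> * Q \<le> E_L n n"
      using \<mu> pn by (auto simp: spectral_bound_def P_def Q_def)
    have int: "E_L p n \<le> - d * (mass p * mass n)"
      by (rule d(2)[OF pn]) (auto simp: p_def n_def)
    have mass: "0 \<le> mass p" "0 \<le> mass n" by (auto simp: p_def n_def mass_nonneg)
    have "0 \<le> d * (mass p * mass n)" using mass d(1) by simp
    then have "E_L p n \<le> 0" using int by simp
    then have up: "E_L p p \<le> \<mu> * P + 4 * \<delta>" "E_L n n \<le> \<mu> * Q + 4 * \<delta>"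
      using E lower excess by (auto simp: distrib_left)
    have "E_L p p \<le> (\<mu> + 4) * P" "E_L n n \<le> (\<mu> + 4) * Q"
      using up P Q \<delta>(2) by (auto simp: distrib_right)
    then have "e * P \<le> (mass p)\<^sup>2" "e * Q \<le> (mass n)\<^sup>2"
      using e(2) pn by (auto simp: P_def Q_def p_def n_def)
    then have "(e * P) * (e * Q) \<le> (mass p)\<^sup>2 * (mass n)\<^sup>2"
      using e(1) P Q s' by (intro mult_mono) auto
    moreover have "(e * s') * (e * s') \<le> (e * P) * (e * Q)"
      using e(1) P Q s' by (intro mult_mono) auto
    ultimately have "(e * s')\<^sup>2 \<le> (mass p * mass n)\<^sup>2"
      by (simp add: power2_eq_square algebra_simps)
    moreover have "0 \<le> mass p * mass n" using mass by simp
    ultimately have "e * s' \<le> mass p * mass n" by (rule power2_le_imp_le)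
    then have "d * (e * s') \<le> d * (mass p * mass n)" using d(1) by (intro mult_left_mono) auto
    also have "\<dots> \<le> 2 * \<delta>"
      using excess[unfolded E distrib_left] lower int by linarith
    also have "\<dots> \<le> d * (e * s') / 2" using \<delta>(3) by (simp add: mult.assoc)
    finally have "d * (e * s') \<le> d * (e * s') / 2" .
    moreover have "0 < d * (e * s')" using d(1) e(1) s'(1) by simp
    ultimately show False by linarith
  qed
qed

lemma spectral_bound_Inf:
  defines "S \<equiv> {E_L u u | u. u \<in> H \<and> L2_inner u u = 1}"
  shows "spectral_bound (Inf S)" and "bdd_below S"
proof -
  obtain C where C: "0 \<le> C" "\<And>u. u \<in> H \<Longrightarrow> \<bar>E_L u u - E_form u u\<bar> \<le> C * L2_inner u u"
    using E_L_close_to_E_form by blast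
  have lower: "- C * L2_inner u u \<le> E_L u u" if "u \<in> H" for u
    using C(2)[OF that] E_form_self_nonneg[of u] by simp
  then show bdd: "bdd_below S" unfolding S_def by (intro bdd_belowI[of _ "- C"]) fastforce
  show "spectral_bound (Inf S)"
    unfolding spectral_bound_def
  proof
    fix v assume v: "v \<in> H"
    show "Inf S * L2_inner v v \<le> E_L v v"
    proof (cases "L2_inner v v = 0")
      case True
      then show ?thesis using lower[OF v] by simp
    next
      case False
      define r where "r = L2_inner v v"
      have r: "0 < r" using False L2_inner_self_nonneg[of v] by (simp add: r_def)
      let ?w = "\<lambda>x. (1 / sqrt r) * v x"
      have "L2_inner ?w ?w = 1" "E_L ?w ?w = E_L v v / r"
        using r v by (simp_all only: L2_inner_scale E_L_scale r_def[symmetric]) (auto simp: power_divide)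
      then have "E_L v v / r \<in> S" unfolding S_def using H_scale[OF v, of "1 / sqrt r"]
        by (intro CollectI exI[of _ ?w]) metis
      then have "Inf S \<le> E_L v v / r" using bdd by (rule cInf_lower)
      then show ?thesis using r by (simp add: r_def[symmetric] le_divide_eq)
    qed
  qed
qed

text \<open>Near minimizers are close in \<open>L\<^sup>2\<close>, and by the excess estimate their difference then has
  small energy as well, so the sequence is Cauchy in the energy norm. Its limit has
  nonzero norm, and the deficit \<open>E_L v v - \<mu> \<parallel>v\<parallel>\<^sup>2\<close> of the limit vanishes because the deficit is a
  nonnegative quadratic form that is bounded by the energy norm.\<close>
lemma minimizing_sequence_limit:
  assumes \<mu>: "spectral_bound \<mu>" and u: "\<And>n. u n \<in> H" and nonneg: "\<And>n x. 0 \<le> u n x"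
    and unit: "\<And>n. L2_inner (u n) (u n) = 1" and lim: "(\<lambda>n. E_L (u n) (u n)) \<longlonglongrightarrow> \<mu>"
  obtains v where "v \<in> H" "L2_inner v v > 0" "E_L v v \<le> \<mu> * L2_inner v v"
proof -
  obtain C where C: "0 \<le> C" "\<And>u. u \<in> H \<Longrightarrow> \<bar>E_L u u - E_form u u\<bar> \<le> C * L2_inner u u"
    using E_L_close_to_E_form by blast
  define M where "M = \<bar>\<mu>\<bar> + C + 1"
  have M: "0 < M" "C \<le> M" "\<mu> + C + 1 \<le> M" "1 \<le> M" "C - \<mu> \<le> M" using C(1) by (auto simp: M_def)
  have ev: "\<exists>N. \<forall>n\<ge>N. E_L (u n) (u n) \<le> \<mu> + \<delta>" if "0 < \<delta>" for \<delta>
  proof -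
    have "eventually (\<lambda>n. E_L (u n) (u n) < \<mu> + \<delta>) sequentially"
      using lim that by (intro order_tendstoD(2)) auto
    then show ?thesis unfolding eventually_sequentially by (meson less_imp_le)
  qed
  have "\<exists>N. \<forall>i\<ge>N. \<forall>j\<ge>N. energy_norm2 (\<lambda>x. u i x - u j x) < e" if "0 < e" for e
  proof -
    obtain \<delta> where \<delta>: "0 < \<delta>"
      "\<And>u v. u \<in> H \<Longrightarrow> v \<in> H \<Longrightarrow> (\<And>x. 0 \<le> u x) \<Longrightarrow> (\<And>x. 0 \<le> v x) \<Longrightarrow>
       L2_inner u u = 1 \<Longrightarrow> L2_inner v v = 1 \<Longrightarrow> E_L u u \<le> \<mu> + \<delta> \<Longrightarrow> E_L v v \<le> \<mu> + \<delta> \<Longrightarrow>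
       L2_inner (\<lambda>x. u x - v x) (\<lambda>x. u x - v x) < e / (2 * M)"
      using near_minimizers_close[OF \<mu>, of "e / (2 * M)"] M(1) \<open>0 < e\<close> by auto
    define \<epsilon> where "\<epsilon> = min \<delta> (e / 8)"
    have \<epsilon>: "0 < \<epsilon>" "\<epsilon> \<le> \<delta>" "\<epsilon> \<le> e / 8" using \<delta>(1) \<open>0 < e\<close> by (auto simp: \<epsilon>_def)
    obtain N where N: "\<And>n. n \<ge> N \<Longrightarrow> E_L (u n) (u n) \<le> \<mu> + \<epsilon>" using ev[OF \<epsilon>(1)] by blast
    have "energy_norm2 (\<lambda>x. u i x - u j x) < e" if ij: "i \<ge> N" "j \<ge> N" for i j
    proof -
      let ?w = "\<lambda>x. u i x - u j x"
      define L where "L = L2_inner ?w ?w"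
      have L: "0 \<le> L" by (simp add: L_def L2_inner_self_nonneg)
      have "L < e / (2 * M)"
        unfolding L_def using N[OF ij(1)] N[OF ij(2)] \<epsilon> by (intro \<delta>(2) u nonneg unit) auto
      then have "M * L < e / 2" using M(1) by (simp add: field_simps)
      moreover have "E_L ?w ?w \<le> \<mu> * L + 4 * \<epsilon>"
        unfolding L_def using N[OF ij(1)] N[OF ij(2)] by (intro near_minimizers_excess \<mu> u unit)
      moreover have "E_form ?w ?w \<le> E_L ?w ?w + C * L"
        using C(2)[OF H_diff[OF u u], of i j] by (simp add: L_def abs_le_iff)
      moreover have "(\<mu> + C + 1) * L \<le> M * L" using M(3) L by (rule mult_right_mono)
      ultimately show ?thesis using \<epsilon>(3) unfolding energy_norm2_def L_def[symmetric]
        by (simp add: distrib_right)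
    qed
    then show ?thesis by blast
  qed
  then obtain v where v: "v \<in> H" and conv: "(\<lambda>n. energy_norm2 (\<lambda>x. u n x - v x)) \<longlonglongrightarrow> 0"
    using H_complete[of u] u by blast
  have bound: "E_L v v - \<mu> * L2_inner v v \<le>
      2 * (E_L (u n) (u n) - \<mu>) + 2 * (M * energy_norm2 (\<lambda>x. u n x - v x))"
    and half: "1 \<le> 2 * L2_inner v v + 2 * energy_norm2 (\<lambda>x. u n x - v x)" for n
  proof -
    let ?w = "\<lambda>x. u n x - v x" and ?z = "\<lambda>x. 2 * u n x + (- 1) * v x"
    have w: "?w \<in> H" by (intro H_diff u v)
    have z: "?z \<in> H" by (intro H_lincomb u v)
    have "\<mu> * L2_inner ?z ?z \<le> E_L ?z ?z" using \<mu> z by (simp add: spectral_bound_def)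
    \<comment> \<open>parallelogram identity for the deficit at \<open>v = u n - w\<close> and at \<open>z = u n + w\<close>; the latter is dropped\<close>
    then have "E_L v v - \<mu> * L2_inner v v \<le> 2 * (E_L (u n) (u n) - \<mu>) + 2 * (E_L ?w ?w - \<mu> * L2_inner ?w ?w)"
      unfolding E_L_quadratic[OF u v] L2_inner_quadratic[OF u v] E_L_diff[OF u v] L2_inner_diff[OF u v] unit
      by (simp add: algebra_simps)
    also have "E_L ?w ?w - \<mu> * L2_inner ?w ?w \<le> M * energy_norm2 ?w"
    proof -
      have "E_L ?w ?w \<le> E_form ?w ?w + C * L2_inner ?w ?w" using C(2)[OF w] by (simp add: abs_le_iff)
      moreover have "(C - \<mu>) * L2_inner ?w ?w \<le> M * L2_inner ?w ?w"
        using M(5) L2_inner_self_nonneg by (rule mult_right_mono)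
      moreover have "1 * E_form ?w ?w \<le> M * E_form ?w ?w"
        using M(4) E_form_self_nonneg by (rule mult_right_mono)
      ultimately show ?thesis by (simp add: energy_norm2_def distrib_left left_diff_distrib)
    qed
    finally show "E_L v v - \<mu> * L2_inner v v \<le>
      2 * (E_L (u n) (u n) - \<mu>) + 2 * (M * energy_norm2 ?w)" by simp
    have "0 \<le> L2_inner (\<lambda>x. 1 * u n x + (- 2) * v x) (\<lambda>x. 1 * u n x + (- 2) * v x)"
      by (rule L2_inner_self_nonneg)
    then have "1 \<le> 2 * L2_inner v v + 2 * L2_inner ?w ?w"
      unfolding L2_inner_quadratic[OF u v] L2_inner_diff[OF u v] unit by (simp add: algebra_simps)
    then show "1 \<le> 2 * L2_inner v v + 2 * energy_norm2 ?w"
      using E_form_self_nonneg[of ?w] by (simp add: energy_norm2_def)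
  qed
  show thesis
  proof (rule that[OF v])
    have "(\<lambda>n. 2 * L2_inner v v + 2 * energy_norm2 (\<lambda>x. u n x - v x)) \<longlonglongrightarrow> 2 * L2_inner v v + 2 * 0"
      by (intro tendsto_intros conv)
    then have "1 \<le> 2 * L2_inner v v + 2 * 0" by (rule LIMSEQ_le_const) (use half in auto)
    then show "0 < L2_inner v v" by simp
    have "(\<lambda>n. 2 * (E_L (u n) (u n) - \<mu>) + 2 * (M * energy_norm2 (\<lambda>x. u n x - v x)))
        \<longlonglongrightarrow> 2 * (\<mu> - \<mu>) + 2 * (M * 0)"
      by (intro tendsto_intros conv lim)
    then have "E_L v v - \<mu> * L2_inner v v \<le> 2 * (\<mu> - \<mu>) + 2 * (M * 0)"
      by (rule LIMSEQ_le_const) (use bound in auto)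
    then show "E_L v v \<le> \<mu> * L2_inner v v" by simp
  qed
qed

text \<open>Passing to absolute values does not increase \<open>E_L\<close>, so there are nonnegative minimizing
  sequences, and likewise the limit may be replaced by its absolute value. The hypothesis
  says that the set of admissible functions is not empty; a nontrivial weak solution will
  provide it.\<close>
lemma ground_state_exists:
  assumes "u \<in> H" "L2_inner u u \<noteq> 0"
  obtains \<phi> \<mu> where "\<phi> \<in> H" "\<And>x. 0 \<le> \<phi> x" "L2_inner \<phi> \<phi> = 1" "E_L \<phi> \<phi> = \<mu>" "spectral_bound \<mu>"
proof -
  define S where "S = {E_L u u | u. u \<in> H \<and> L2_inner u u = 1}"
  define \<mu> where "\<mu> = Inf S"
  have \<mu>: "spectral_bound \<mu>" and bdd: "bdd_below S"
    using spectral_bound_Inf by (simp_all add: S_def \<mu>_def)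
  have normalize: "\<exists>s. (\<lambda>x. s * v x) \<in> H \<and> 0 \<le> s \<and> s\<^sup>2 * L2_inner v v = 1" if "v \<in> H" "L2_inner v v \<noteq> 0" for v
    using that L2_inner_self_nonneg[of v] H_scale[of v "1 / sqrt (L2_inner v v)"]
    by (intro exI[of _ "1 / sqrt (L2_inner v v)"]) (auto simp: power_divide)
  obtain s where "(\<lambda>x. s * u x) \<in> H" "s\<^sup>2 * L2_inner u u = 1"
    using normalize[OF assms] by auto
  then have "E_L (\<lambda>x. s * u x) (\<lambda>x. s * u x) \<in> S"
    unfolding S_def using L2_inner_scale[OF assms(1), of s]
    by (intro CollectI exI[of _ "\<lambda>x. s * u x"]) simp
  then have "S \<noteq> {}" by blast
  have "\<exists>v. v \<in> H \<and> (\<forall>x. 0 \<le> v x) \<and> L2_inner v v = 1 \<and> E_L v v \<le> \<mu> + 1 / real (Suc n)" for n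
  proof -
    have "Inf S < \<mu> + 1 / real (Suc n)" by (simp add: \<mu>_def)
    then obtain c where "c \<in> S" "c < \<mu> + 1 / real (Suc n)" using \<open>S \<noteq> {}\<close> cInf_lessD by blast
    then obtain w where w: "w \<in> H" "L2_inner w w = 1" "E_L w w < \<mu> + 1 / real (Suc n)"
      by (auto simp: S_def)
    then show ?thesis
      using E_L_abs_le[OF w(1)] L2_inner_abs[of w] H_abs[OF w(1)]
      by (intro exI[of _ "\<lambda>x. \<bar>w x\<bar>"]) auto
  qed
  then have "\<forall>n. \<exists>v. v \<in> H \<and> (\<forall>x. 0 \<le> v x) \<and> L2_inner v v = 1 \<and> E_L v v \<le> \<mu> + 1 / real (Suc n)"
    by (rule allI)
  from choice[OF this] obtain v where "\<forall>n. v n \<in> H \<and> (\<forall>x. 0 \<le> v n x) \<and>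
      L2_inner (v n) (v n) = 1 \<and> E_L (v n) (v n) \<le> \<mu> + 1 / real (Suc n)" by (elim exE)
  then have v: "\<And>n. v n \<in> H" "\<And>n x. 0 \<le> v n x" "\<And>n. L2_inner (v n) (v n) = 1"
    and vE: "\<And>n. E_L (v n) (v n) \<le> \<mu> + 1 / real (Suc n)" by auto
  have "\<mu> \<le> E_L (v n) (v n)" for n
    using bspec[OF \<mu>[unfolded spectral_bound_def] v(1)[of n]] v(3)[of n] by simp
  then have lower: "\<forall>\<^sub>F n in sequentially. \<mu> \<le> E_L (v n) (v n)"
    by (intro always_eventually allI)
  have "(\<lambda>n. E_L (v n) (v n)) \<longlonglongrightarrow> \<mu>"
  proof (rule tendsto_sandwich)
    show "\<forall>\<^sub>F n in sequentially. \<mu> \<le> E_L (v n) (v n)" by (rule lower)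
    show "\<forall>\<^sub>F n in sequentially. E_L (v n) (v n) \<le> \<mu> + 1 / real (Suc n)" using vE by simp
    have "(\<lambda>n. \<mu> + 1 / real (Suc n)) \<longlonglongrightarrow> \<mu> + 0"
      by (intro tendsto_add tendsto_const LIMSEQ_Suc[OF lim_1_over_n])
    then show "(\<lambda>n. \<mu> + 1 / real (Suc n)) \<longlonglongrightarrow> \<mu>" by simp
  qed simp
  then obtain w where w: "w \<in> H" "L2_inner w w > 0" "E_L w w \<le> \<mu> * L2_inner w w"
    using minimizing_sequence_limit[of \<mu> v, OF \<mu> v] by blast
  define z where "z = (\<lambda>x. \<bar>w x\<bar>)"
  have z: "z \<in> H" "L2_inner z z > 0" "E_L z z \<le> \<mu> * L2_inner z z" "\<And>x. 0 \<le> z x"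
    using H_abs[OF w(1)] L2_inner_abs[of w] E_L_abs_le[OF w(1)] w by (auto simp: z_def)
  obtain s where s: "(\<lambda>x. s * z x) \<in> H" "0 \<le> s" "s\<^sup>2 * L2_inner z z = 1"
    using normalize[of z] z by auto
  have 1: "L2_inner (\<lambda>x. s * z x) (\<lambda>x. s * z x) = 1" using s z by (simp add: L2_inner_scale)
  have "E_L (\<lambda>x. s * z x) (\<lambda>x. s * z x) = s\<^sup>2 * E_L z z" using z by (simp add: E_L_scale)
  also have "\<dots> \<le> s\<^sup>2 * (\<mu> * L2_inner z z)" using z by (intro mult_left_mono) auto
  also have "\<dots> = \<mu>" using s(3) by (simp add: algebra_simps)
  finally have "E_L (\<lambda>x. s * z x) (\<lambda>x. s * z x) = \<mu>"
    using \<mu> s(1) 1 by (auto simp: spectral_bound_def dest!: bspec[OF _ s(1)])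
  then show thesis using that[of "\<lambda>x. s * z x" \<mu>] s z 1 \<mu> by simp
qed

lemma first_eigenvalue_eqI:
  assumes "\<phi> \<in> H" "L2_inner \<phi> \<phi> = 1" "E_L \<phi> \<phi> = \<mu>" "spectral_bound \<mu>"
  shows "first_eigenvalue \<Omega> = \<mu>"
proof -
  have norm: "L2_norm_on \<Omega> u = sqrt (L2_inner u u)" if "u \<in> H" for u
  proof -
    have "indicator \<Omega> x *\<^sub>R (u x)\<^sup>2 = (u x)\<^sup>2" for x
      using H_outside[OF that, of x] by (auto simp: indicator_def)
    then show ?thesis by (simp only: L2_norm_on_def set_lebesgue_integral_def L2_inner_self)
  qed
  show ?thesis unfolding first_eigenvalue_def
  proof (rule Least_equality)
    show "\<mu> \<in> {E_L u u | u. u \<in> H \<and> L2_norm_on \<Omega> u = 1}" using assms by (auto simp: norm)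
    fix c assume "c \<in> {E_L u u | u. u \<in> H \<and> L2_norm_on \<Omega> u = 1}"
    then obtain u where "u \<in> H" "L2_inner u u = 1" "c = E_L u u" by (auto simp: norm)
    then show "\<mu> \<le> c" using assms(4) by (auto simp: spectral_bound_def dest!: bspec)
  qed
qed

section \<open>Sign-changing solutions and the hyperbola bound\<close>

text \<open>The deficit \<open>E_L v v - \<mu> \<parallel>v\<parallel>\<^sup>2\<close> is a nonnegative quadratic form that vanishes at \<open>\<phi>\<close>. Hence \<open>\<phi>\<close>
  lies in the kernel of its polar form.\<close>
lemma first_variation:
  assumes \<mu>: "spectral_bound \<mu>" and \<phi>: "\<phi> \<in> H" "E_L \<phi> \<phi> = \<mu> * L2_inner \<phi> \<phi>" and v: "v \<in> H"
  shows "E_L \<phi> v = \<mu> * L2_inner \<phi> v"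
proof -
  define B F where "B = E_L \<phi> v - \<mu> * L2_inner \<phi> v" and "F = E_L v v - \<mu> * L2_inner v v"
  have F: "0 \<le> F" using \<mu> v by (simp add: F_def spectral_bound_def)
  \<comment> \<open>a nearly optimal step; the summand 1 keeps the denominator positive when \<open>F = 0\<close>\<close>
  define t where "t = - B / (F + 1)"
  let ?w = "\<lambda>x. 1 * \<phi> x + t * v x"
  have "\<mu> * L2_inner ?w ?w \<le> E_L ?w ?w"
    using \<mu> H_lincomb[OF \<phi>(1) v, of 1 t] unfolding spectral_bound_def by blast
  then have "0 \<le> 2 * t * B + t\<^sup>2 * F"
    unfolding E_L_quadratic[OF \<phi>(1) v] L2_inner_quadratic[OF \<phi>(1) v] \<phi>(2) B_def F_def
    by (simp add: algebra_simps)
  then have "0 \<le> (2 * t * B + t\<^sup>2 * F) * (F + 1)\<^sup>2" by simp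
  also have "\<dots> = - B\<^sup>2 * (F + 2)"
  proof -
    have "t * (F + 1) = - B" using F by (simp add: t_def)
    then have "2 * (t * (F + 1)) * B * (F + 1) + (t * (F + 1))\<^sup>2 * F = - B\<^sup>2 * (F + 2)"
      by (simp add: power2_eq_square algebra_simps)
    then show ?thesis by (simp add: power2_eq_square algebra_simps)
  qed
  finally have "B\<^sup>2 * (F + 2) \<le> 0" by simp
  then have "B = 0" using F by (simp add: mult_le_0_iff)
  then show ?thesis by (simp add: B_def)
qed

lemma AE_eq_0_if_L2_inner_0:
  assumes "u \<in> H" "L2_inner u u = 0"
  shows "AE x in lborel. u x = 0"
  using assms integral_nonneg_eq_0_iff_AE[OF H_integrable_square[OF assms(1)]]
  by (simp add: L2_inner_self)

lemma mass_pos: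
  assumes "u \<in> H" "AE x in lborel. 0 \<le> u x" "\<not> (AE x in lborel. u x = 0)"
  shows "0 < mass u"
  using mass_nonneg[OF assms(2)] integral_nonneg_eq_0_iff_AE[OF H_integrable[OF assms(1)] assms(2)] assms(3)
  by (auto simp: mass_def)

definition weak_solution :: "real \<Rightarrow> real \<Rightarrow> ('a \<Rightarrow> real) \<Rightarrow> bool" where
  "weak_solution a b u \<longleftrightarrow> u \<in> H \<and> \<not> (AE x in lborel. u x = 0) \<and>
     (\<forall>v\<in>H. E_L u v = a * L2_inner (pos_part u) v - b * L2_inner (neg_part u) v)"

lemma fucik_spectrum_iff: "(a, b) \<in> fucik_spectrum \<Omega> \<longleftrightarrow> (\<exists>u. weak_solution a b u)"
proof -
  have "(LINT x:\<Omega>|lborel. (a * pos_part u x - b * neg_part u x) * v x) =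
      a * L2_inner (pos_part u) v - b * L2_inner (neg_part u) v" if "u \<in> H" "v \<in> H" for u v
  proof -
    have "indicator \<Omega> x *\<^sub>R ((a * pos_part u x - b * neg_part u x) * v x) =
        (a * pos_part u x + (- b) * neg_part u x) * v x" for x
      using H_outside[OF that(2), of x] by (auto simp: indicator_def)
    then have "(LINT x:\<Omega>|lborel. (a * pos_part u x - b * neg_part u x) * v x) =
        L2_inner (\<lambda>x. a * pos_part u x + (- b) * neg_part u x) v"
      by (simp only: set_lebesgue_integral_def L2_inner_def)
    also have "\<dots> = a * L2_inner (pos_part u) v - b * L2_inner (neg_part u) v"
      unfolding L2_inner_lincomb_left[OF H_pos_part[OF that(1)] H_neg_part[OF that(1)] that(2)] by simp
    finally show ?thesis .
  qed
  then show ?thesis by (auto simp: fucik_spectrum_def weak_solution_def Bex_def)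
qed

text \<open>This symmetry turns every statement about negative parts and \<open>a\<close> into one about positive
  parts and \<open>b\<close>.\<close>
lemma weak_solution_uminus:
  assumes "weak_solution a b u"
  shows "weak_solution b a (\<lambda>x. - u x)"
proof -
  have u: "u \<in> H" using assms by (simp add: weak_solution_def)
  have "pos_part (\<lambda>x. - u x) = neg_part u" "neg_part (\<lambda>x. - u x) = pos_part u"
    by (auto simp: pos_part_def neg_part_def)
  moreover have "E_L (\<lambda>x. - u x) v = - E_L u v" if "v \<in> H" for v
    using E_L_lincomb_left[OF u u that, of "- 1" 0] by simp
  ultimately show ?thesis using assms H_scale[OF u, of "- 1"] by (simp add: weak_solution_def)
qed

text \<open>Otherwise \<open>u \<ge> 0\<close>, and comparing the equation for \<open>u\<close>, tested with \<open>\<phi>\<close>, with the equation for \<open>\<phi>\<close>,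
  tested with \<open>u\<close>, gives \<open>(a - \<mu>) \<integral>u \<phi> = 0\<close>. Thus \<open>u \<phi> = 0\<close> almost everywhere and \<open>E_L u \<phi> = 0\<close>,
  contrary to the strict negativity of the interaction of two nontrivial nonnegative
  functions with disjoint supports.\<close>
lemma weak_solution_neg_part_nontrivial:
  assumes \<phi>: "\<phi> \<in> H" "\<And>x. 0 \<le> \<phi> x" "L2_inner \<phi> \<phi> = 1" "E_L \<phi> \<phi> = \<mu>" and \<mu>: "spectral_bound \<mu>"
    and u: "weak_solution a b u" and a: "\<mu> < a"
  shows "0 < L2_inner (neg_part u) (neg_part u)"
proof (rule ccontr)
  assume "\<not> 0 < L2_inner (neg_part u) (neg_part u)"
  then have "L2_inner (neg_part u) (neg_part u) = 0"
    using L2_inner_self_nonneg[of "neg_part u"] by linarith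
  moreover have uH: "u \<in> H" using u by (simp add: weak_solution_def)
  ultimately have n0: "AE x in lborel. neg_part u x = 0"
    by (intro AE_eq_0_if_L2_inner_0 H_neg_part)
  have u0: "AE x in lborel. 0 \<le> u x"
    using n0 by eventually_elim (auto simp: neg_part_def max_def split: if_splits)
  obtain d where d: "d > 0"
    "\<And>p n. p \<in> H \<Longrightarrow> n \<in> H \<Longrightarrow> AE x in lborel. 0 \<le> p x \<Longrightarrow> AE x in lborel. 0 \<le> n x \<Longrightarrow>
       AE x in lborel. p x * n x = 0 \<Longrightarrow> E_L p n \<le> - d * (mass p * mass n)"
    using separated_interaction by blast
  have "L2_inner (neg_part u) \<phi> = L2_inner (\<lambda>x. 0) \<phi>"
    unfolding L2_inner_def
    by (rule integral_cong_AE)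
      (use n0 H_measurable[OF H_neg_part[OF uH]] H_measurable[OF \<phi>(1)] in auto)
  then have n\<phi>: "L2_inner (neg_part u) \<phi> = 0" by (simp add: L2_inner_def)
  have "L2_inner u \<phi> = L2_inner (pos_part u) \<phi>"
    using L2_inner_lincomb_left[OF H_pos_part[OF uH] H_neg_part[OF uH] \<phi>(1), of 1 "- 1",
      unfolded pos_neg_lincomb[symmetric]] n\<phi> by simp
  moreover have "E_L u \<phi> = a * L2_inner (pos_part u) \<phi>"
    using u \<phi>(1) n\<phi> by (simp add: weak_solution_def)
  moreover have "E_L u \<phi> = \<mu> * L2_inner u \<phi>"
    using first_variation[OF \<mu> \<phi>(1) _ uH] \<phi> E_L_commute[OF uH \<phi>(1)] L2_inner_commute[of u \<phi>] by simp
  ultimately have "(a - \<mu>) * L2_inner u \<phi> = 0" and E: "E_L u \<phi> = a * L2_inner u \<phi>"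
    by (auto simp: algebra_simps)
  then have L0: "L2_inner u \<phi> = 0" using a by simp
  have "AE x in lborel. 0 \<le> u x * \<phi> x" using u0 by eventually_elim (simp add: \<phi>)
  then have "AE x in lborel. u x * \<phi> x = 0"
    using L0 integral_nonneg_eq_0_iff_AE[OF H_integrable_mult[OF uH \<phi>(1)]] by (simp add: L2_inner_def)
  then have "E_L u \<phi> \<le> - d * (mass u * mass \<phi>)"
    using uH \<phi> u0 by (intro d(2)) auto
  moreover have "0 < mass u" using uH u0 u by (intro mass_pos) (auto simp: weak_solution_def)
  moreover have "0 < mass \<phi>"
  proof (rule mass_pos[OF \<phi>(1)])
    show "\<not> (AE x in lborel. \<phi> x = 0)"
    proof
      assume "AE x in lborel. \<phi> x = 0"
      then have "L2_inner \<phi> \<phi> = L2_inner (\<lambda>x. 0) (\<lambda>x. 0)"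
        unfolding L2_inner_def
        by (intro integral_cong_AE) (use H_measurable[OF \<phi>(1)] in auto)
      then show False using \<phi>(3) by (simp add: L2_inner_def)
    qed
  qed (use \<phi> in auto)
  ultimately have "E_L u \<phi> \<le> - d * (mass u * mass \<phi>)" "0 < d * (mass u * mass \<phi>)"
    using d(1) by auto
  then show False using E L0 by simp
qed

text \<open>In a bounded part of the plane, the points of the spectrum above and to the right of
  \<open>(\<mu>, \<mu>)\<close> lie beyond a hyperbola whose asymptotes are the two lines in question.\<close>
lemma fucik_hyperbola:
  assumes \<phi>: "\<phi> \<in> H" "\<And>x. 0 \<le> \<phi> x" "L2_inner \<phi> \<phi> = 1" "E_L \<phi> \<phi> = \<mu>" and \<mu>: "spectral_bound \<mu>"
  obtains \<eta> where "0 < \<eta>"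
    "\<And>a b. (a, b) \<in> fucik_spectrum \<Omega> \<Longrightarrow> \<mu> < a \<Longrightarrow> \<mu> < b \<Longrightarrow> a \<le> B \<Longrightarrow> b \<le> B \<Longrightarrow>
       \<eta> \<le> (a - \<mu>) * (b - \<mu>)"
proof -
  obtain d where d: "d > 0"
    "\<And>p n. p \<in> H \<Longrightarrow> n \<in> H \<Longrightarrow> AE x in lborel. 0 \<le> p x \<Longrightarrow> AE x in lborel. 0 \<le> n x \<Longrightarrow>
       AE x in lborel. p x * n x = 0 \<Longrightarrow> E_L p n \<le> - d * (mass p * mass n)"
    using separated_interaction by blast
  obtain e where e: "e > 0"
    "\<And>w. w \<in> H \<Longrightarrow> (\<And>x. 0 \<le> w x) \<Longrightarrow> E_L w w \<le> B * L2_inner w w \<Longrightarrow> e * L2_inner w w \<le> (mass w)\<^sup>2"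
    using reverse_Hoelder[of B] by blast
  show thesis
  proof (rule that[of "(d * e)\<^sup>2"])
    show "0 < (d * e)\<^sup>2" using d(1) e(1) by simp
    fix a b
    assume ab: "(a, b) \<in> fucik_spectrum \<Omega>" "\<mu> < a" "\<mu> < b" "a \<le> B" "b \<le> B"
    then obtain u where u: "weak_solution a b u" by (auto simp: fucik_spectrum_iff)
    then have uH: "u \<in> H" by (simp add: weak_solution_def)
    define p n where "p = pos_part u" and "n = neg_part u"
    have pn: "p \<in> H" "n \<in> H" using uH by (auto simp: p_def n_def H_pos_part H_neg_part)
    define P Q where "P = L2_inner p p" and "Q = L2_inner n n"
    have Q: "0 < Q"
      using weak_solution_neg_part_nontrivial[OF \<phi> \<mu> u ab(2)] by (simp add: Q_def n_def)
    have "neg_part (\<lambda>x. - u x) = p" by (simp add: p_def neg_part_def pos_part_def fun_eq_iff)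
    then have P: "0 < P"
      using weak_solution_neg_part_nontrivial[OF \<phi> \<mu> weak_solution_uminus[OF u] ab(3)]
      by (simp add: P_def)
    define I where "I = mass p * mass n"
    have I: "0 \<le> I" by (simp add: I_def p_def n_def mass_nonneg)
    have int: "E_L p n \<le> - d * I"
      unfolding I_def by (rule d(2)[OF pn]) (auto simp: p_def n_def)
    have split: "E_L u v = E_L p v - E_L n v" if "v \<in> H" for v
      using E_L_lincomb_left[OF pn that, of 1 "- 1"] unfolding p_def n_def pos_neg_lincomb[symmetric] by simp
    have pn0: "L2_inner p n = 0" "L2_inner n p = 0"
      using L2_inner_commute[of n p] by (simp_all add: p_def n_def)
    have test: "E_L u v = a * L2_inner p v - b * L2_inner n v" if "v \<in> H" for v
      using u that by (simp add: weak_solution_def p_def n_def)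
    have Ep: "E_L p p = a * P + E_L p n"
      using split[OF pn(1)] test[OF pn(1)] pn0 E_L_commute[OF pn] by (simp add: P_def)
    have En: "E_L n n = b * Q + E_L p n"
      using split[OF pn(2)] test[OF pn(2)] pn0 by (simp add: Q_def)
    have lower: "\<mu> * P \<le> E_L p p" "\<mu> * Q \<le> E_L n n"
      using \<mu> pn by (auto simp: spectral_bound_def P_def Q_def)
    \<comment> \<open>excess energy of each part above \<open>\<mu>\<close> must pay for the interaction\<close>
    have dI: "d * I \<le> (a - \<mu>) * P" "d * I \<le> (b - \<mu>) * Q"
      using Ep En lower int by (auto simp: left_diff_distrib)
    have "0 \<le> d * I" using d(1) I by simp
    then have "E_L p p \<le> a * P" "E_L n n \<le> b * Q" using Ep En int by auto
    moreover have "a * P \<le> B * P" "b * Q \<le> B * Q" using ab P Q by auto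
    ultimately have "e * P \<le> (mass p)\<^sup>2" "e * Q \<le> (mass n)\<^sup>2"
      using e(2) pn by (auto simp: P_def Q_def p_def n_def)
    then have "(e * P) * (e * Q) \<le> (mass p)\<^sup>2 * (mass n)\<^sup>2"
      using e(1) P Q by (intro mult_mono) auto
    then have "d\<^sup>2 * ((e * P) * (e * Q)) \<le> d\<^sup>2 * I\<^sup>2"
      by (intro mult_left_mono) (auto simp: I_def power_mult_distrib)
    also have "\<dots> = (d * I) * (d * I)" by (simp add: power2_eq_square)
    also have "\<dots> \<le> ((a - \<mu>) * P) * ((b - \<mu>) * Q)"
      by (rule mult_mono) (use dI \<open>0 \<le> d * I\<close> ab P in auto)
    finally have "(d * e)\<^sup>2 * (P * Q) \<le> ((a - \<mu>) * (b - \<mu>)) * (P * Q)"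
      by (simp add: power2_eq_square algebra_simps)
    then show "(d * e)\<^sup>2 \<le> (a - \<mu>) * (b - \<mu>)" using P Q by simp
  qed
qed

end

theorem theorem4p2:
  fixes \<Omega> :: "'a::euclidean_space set"
  assumes "\<Omega> \<noteq> {}" and "open \<Omega>" and "connected \<Omega>" and "bounded \<Omega>"
    and "C11_boundary \<Omega>"
  shows "\<not> (\<exists>(a :: nat \<Rightarrow> real) (b :: nat \<Rightarrow> real) (\<alpha> :: real) (\<beta> :: real).
           (\<forall>k. (a k, b k) \<in> fucik_spectrum \<Omega> \<and>
                a k > first_eigenvalue \<Omega> \<and> b k > first_eigenvalue \<Omega>) \<and>
           (\<lambda>k. (a k, b k)) \<longlonglongrightarrow> (\<alpha>, \<beta>) \<and>
           (\<alpha> = first_eigenvalue \<Omega> \<or> \<beta> = first_eigenvalue \<Omega>))"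
proof clarify
  fix a b :: "nat \<Rightarrow> real" and \<alpha> \<beta> :: real
  assume ab: "\<forall>k. (a k, b k) \<in> fucik_spectrum \<Omega> \<and>
      first_eigenvalue \<Omega> < a k \<and> first_eigenvalue \<Omega> < b k"
    and lim: "(\<lambda>k. (a k, b k)) \<longlonglongrightarrow> (\<alpha>, \<beta>)"
    and line: "\<alpha> = first_eigenvalue \<Omega> \<or> \<beta> = first_eigenvalue \<Omega>"
  interpret log_laplacian_domain \<Omega>
    using \<open>open \<Omega>\<close> \<open>bounded \<Omega>\<close> by unfold_locales auto
  define \<mu> where "\<mu> = first_eigenvalue \<Omega>"
  obtain u where u: "weak_solution (a 0) (b 0) u" using ab fucik_spectrum_iff by blast
  then have "u \<in> H" "L2_inner u u \<noteq> 0"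
    using AE_eq_0_if_L2_inner_0[of u] by (auto simp: weak_solution_def)
  then obtain \<phi> \<nu> where "\<phi> \<in> H" "\<And>x. 0 \<le> \<phi> x" "L2_inner \<phi> \<phi> = 1" "E_L \<phi> \<phi> = \<nu>" "spectral_bound \<nu>"
    using ground_state_exists by blast
  moreover from this have "\<nu> = \<mu>" using first_eigenvalue_eqI by (simp add: \<mu>_def)
  ultimately have \<phi>: "\<phi> \<in> H" "\<And>x. 0 \<le> \<phi> x" "L2_inner \<phi> \<phi> = 1" "E_L \<phi> \<phi> = \<mu>" "spectral_bound \<mu>"
    by auto
  have a: "a \<longlonglongrightarrow> \<alpha>" and b: "b \<longlonglongrightarrow> \<beta>"
    using tendsto_fst[OF lim] tendsto_snd[OF lim] by simp_all
  obtain \<eta> where \<eta>: "0 < \<eta>"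
    "\<And>a b. (a, b) \<in> fucik_spectrum \<Omega> \<Longrightarrow> \<mu> < a \<Longrightarrow> \<mu> < b \<Longrightarrow> a \<le> max \<alpha> \<beta> + 1 \<Longrightarrow> b \<le> max \<alpha> \<beta> + 1 \<Longrightarrow>
       \<eta> \<le> (a - \<mu>) * (b - \<mu>)"
    using fucik_hyperbola[OF \<phi>, of "max \<alpha> \<beta> + 1"] by blast
  have "\<forall>\<^sub>F k in sequentially. a k < max \<alpha> \<beta> + 1" "\<forall>\<^sub>F k in sequentially. b k < max \<alpha> \<beta> + 1"
    using order_tendstoD(2)[OF a, of "max \<alpha> \<beta> + 1"] order_tendstoD(2)[OF b, of "max \<alpha> \<beta> + 1"] by auto
  then have "\<forall>\<^sub>F k in sequentially. \<eta> \<le> (a k - \<mu>) * (b k - \<mu>)"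
    by eventually_elim (rule \<eta>(2); use ab in \<open>simp add: \<mu>_def less_imp_le\<close>)
  moreover have "(\<lambda>k. (a k - \<mu>) * (b k - \<mu>)) \<longlonglongrightarrow> (\<alpha> - \<mu>) * (\<beta> - \<mu>)"
    by (intro tendsto_intros a b)
  ultimately have "\<eta> \<le> (\<alpha> - \<mu>) * (\<beta> - \<mu>)"
    by (intro tendsto_lowerbound) auto
  then show False using line \<eta>(1) by (auto simp: \<mu>_def)
qed

end
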